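(* Let $A$ be the generator of an exponentially stable $C_0$-semigroup $(e^{At})_{t\ge0}$ on a Hilbert space $H$. Then for every $\alpha>0$ there exist $M>0$ and $t_0>0$ such that \[ \big\|e^{A^{-1}t}(-A)^{-\alpha}\big\|\le \frac{M}{t^{\alpha/2}}\qquad\text{for all } t\ge t_0 . \]
   Context: A $C_0$-semigroup is exponentially stable if $\|e^{At}\|\le Ke^{-\omega t}$ for some $K,\omega>0$ and all $t\ge0$. In that case $0$ lies in the resolvent set of $A$, so $A^{-1}\in\mathcal{L}(H)$ and $e^{A^{-1}t}$ is the (norm-convergent) exponential of the bounded operator $tA^{-1}$. For $\alpha>0$, $(-A)^{-\alpha}\in\mathcal{L}(H)$ denotes the negative fractional power of $-A$ (as defined by the sectorial functional calculus; equivalently $(-A)^{-\alpha}x=\Gamma(\alpha)^{-1}\int_0^\infty t^{\alpha-1}e^{At}x\,dt$), and $(-A)^{\alpha}$ denotes its inverse with domain $D((-A)^\alpha)$. *)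

theory Defs
  imports "HOL-Analysis.Analysis"
begin

definition c0_semigroup :: "(real \<Rightarrow> ('a::real_normed_vector \<Rightarrow>\<^sub>L 'a)) \<Rightarrow> bool" where
  "c0_semigroup T \<longleftrightarrow>
     T 0 = id_blinfun \<and>
     (\<forall>s t. 0 \<le> s \<longrightarrow> 0 \<le> t \<longrightarrow> T (s + t) = T s o\<^sub>L T t) \<and>
     (\<forall>x. ((\<lambda>t. blinfun_apply (T t) x) \<longlongrightarrow> x) (at_right 0))"

definition exp_stable :: "(real \<Rightarrow> ('a::real_normed_vector \<Rightarrow>\<^sub>L 'a)) \<Rightarrow> bool" where
  "exp_stable T \<longleftrightarrow> (\<exists>K \<omega>. K > 0 \<and> \<omega> > 0 \<and> (\<forall>t\<ge>0. norm (T t) \<le> K * exp (- \<omega> * t)))"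

definition gen_dom :: "(real \<Rightarrow> ('a::real_normed_vector \<Rightarrow>\<^sub>L 'a)) \<Rightarrow> 'a set" where
  "gen_dom T = {x. \<exists>y. ((\<lambda>h. (1 / h) *\<^sub>R (blinfun_apply (T h) x - x)) \<longlongrightarrow> y) (at_right 0)}"

definition generator :: "(real \<Rightarrow> ('a::real_normed_vector \<Rightarrow>\<^sub>L 'a)) \<Rightarrow> 'a \<Rightarrow> 'a" where
  "generator T x = Lim (at_right 0) (\<lambda>h. (1 / h) *\<^sub>R (blinfun_apply (T h) x - x))"

text \<open>A^{-1}: the bounded two-sided inverse of the generator (exists when 0 is in the resolvent set).\<close>
definition gen_inv :: "(real \<Rightarrow> ('a::real_normed_vector \<Rightarrow>\<^sub>L 'a)) \<Rightarrow> ('a \<Rightarrow>\<^sub>L 'a)" where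
  "gen_inv T = (THE B. (\<forall>x. blinfun_apply B x \<in> gen_dom T \<and> generator T (blinfun_apply B x) = x) \<and>
                       (\<forall>x\<in>gen_dom T. blinfun_apply B (generator T x) = x))"

definition blinfun_pow :: "('a::real_normed_vector \<Rightarrow>\<^sub>L 'a) \<Rightarrow> nat \<Rightarrow> ('a \<Rightarrow>\<^sub>L 'a)" where
  "blinfun_pow B n = ((\<lambda>C. B o\<^sub>L C) ^^ n) id_blinfun"

definition blinfun_exp :: "('a::banach \<Rightarrow>\<^sub>L 'a) \<Rightarrow> ('a \<Rightarrow>\<^sub>L 'a)" where
  "blinfun_exp B = (\<Sum>n. (1 / fact n) *\<^sub>R blinfun_pow B n)"

definition neg_frac_pow :: "(real \<Rightarrow> ('a::real_normed_vector \<Rightarrow>\<^sub>L 'a)) \<Rightarrow> real \<Rightarrow> ('a \<Rightarrow>\<^sub>L 'a)" where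
  "neg_frac_pow T \<alpha> = Blinfun (\<lambda>x. (1 / Gamma \<alpha>) *\<^sub>R
       integral {0<..} (\<lambda>t. (t powr (\<alpha> - 1)) *\<^sub>R blinfun_apply (T t) x))"

end

theory Submission
  imports Defs
begin

text \<open>
  Write \<open>R = - A\<^sup>-\<^sup>1\<close>, \<open>W a = (-A)\<^sup>-\<^sup>a\<close>, \<open>E t = exp (t A\<^sup>-\<^sup>1)\<close>, and let \<open>w\<close> be the decay rate.

  Since \<open>\<integral> T(s)\<^sup>* T(s) ds\<close> solves the Lyapunov equation of \<open>A\<close>, it also yields
  \<open>\<integral> (norm (R (E t x)))\<^sup>2 dt \<le> c / w * (norm x)\<^sup>2\<close>, and the same holds for the adjoints. Pairing
  \<open>R (E \<tau> x)\<close> with \<open>R\<^sup>* (E (t - \<tau>)\<^sup>* y)\<close> and integrating over \<open>\<tau>\<close> in \<open>[0, t]\<close> gives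
  \<open>norm (R\<^sup>2 E t) \<le> c / (t w)\<close>. Squaring this and interpolating gives
  \<open>norm (W a R\<^sup>2 E t) \<le> c (t w)\<^sup>-\<^sup>1\<^sup>-\<^sup>a\<^sup>/\<^sup>2\<close> for \<open>0 < a \<le> 1\<close>, and integrating in \<open>t\<close> bounds \<open>W a R E t\<close>.

  Replacing \<open>A\<close> by \<open>A - \<xi>\<close> changes \<open>w\<close> into \<open>w + \<xi>\<close> and keeps the constants. The \<open>\<xi>\<close>-derivative of
  \<open>E t W a\<close> is \<open>t R\<^sup>2 E t W a - a W a R E t\<close>, of size \<open>t\<^sup>-\<^sup>a\<^sup>/\<^sup>2 (w + \<xi>)\<^sup>-\<^sup>1\<^sup>-\<^sup>a\<^sup>/\<^sup>2\<close>. This is integrable over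
  \<open>\<xi> \<ge> 0\<close> precisely because \<open>a > 0\<close>, which settles \<open>0 < a \<le> 1\<close>. Larger exponents follow from
  \<open>E t W (a + 1) = (E (t/2) R) (E (t/2) W a)\<close>.
\<close>

section \<open>The exponential of a bounded operator\<close>

text \<open>The obstacle is that \<open>T\<close> is only strongly continuous, so neither
  \<open>T\<close> nor its adjoint can be differentiated in operator norm. A factor \<open>R\<close>
  cures this: \<open>T s o\<^sub>L R\<close> is norm-Lipschitz,
  \<open>T s o\<^sub>L (R o\<^sub>L R)\<close> is norm-differentiable, and both properties survive
  \<open>adj\<close>. The energy estimates are therefore proved with one surplus \<open>R\<close> on
  each side, and the surplus is removed by the approximate identity \<open>Q h\<close>, which
  factors through \<open>R\<close> and is bounded by \<open>K\<close>.

  The detour through \<xi> is forced: the t-derivative of \<open>E t o\<^sub>L W a\<close> is, up to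
  sign, \<open>W a o\<^sub>L R o\<^sub>L E t\<close>, of size t^(-a/2), which for a \<le> 1 is not
  integrable at infinity. Integration in t thus removes one \<open>R\<close> from the estimate with
  \<open>R o\<^sub>L R\<close>, but not the last one. To be integrated over all shifts, the bounds
  must have constants depending on \<open>K\<close> and \<open>a\<close> alone; this is why the
  decay rate is carried along as an explicit power everywhere.\<close>

interpretation blinfun_compose: bounded_bilinear "(o\<^sub>L)"
  by (rule bounded_bilinear_blinfun_compose)

lemma blinfun_compose_assoc: "(A o\<^sub>L B) o\<^sub>L C = A o\<^sub>L (B o\<^sub>L C)"
  by (rule blinfun_eqI) simp

lemma blinfun_compose_id [simp]: "id_blinfun o\<^sub>L A = A" "A o\<^sub>L id_blinfun = A"
  by (rule blinfun_eqI, simp)+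

lemma blinfun_pow_0 [simp]: "blinfun_pow B 0 = id_blinfun"
  and blinfun_pow_Suc: "blinfun_pow B (Suc n) = B o\<^sub>L blinfun_pow B n"
  by (simp_all add: blinfun_pow_def)

lemma norm_blinfun_pow: "norm (blinfun_pow B n) \<le> norm B ^ n"
proof (induction n)
  case (Suc n)
  have "norm (blinfun_pow B (Suc n)) \<le> norm B * norm (blinfun_pow B n)"
    by (simp add: blinfun_pow_Suc norm_blinfun_compose)
  also have "\<dots> \<le> norm B * norm B ^ n"
    by (intro mult_left_mono Suc) auto
  finally show ?case by simp
qed (simp add: norm_blinfun_id_le)

lemma blinfun_pow_scaleR: "blinfun_pow (t *\<^sub>R B) n = t ^ n *\<^sub>R blinfun_pow B n"
  by (induction n) (simp_all add: blinfun_pow_Suc blinfun_compose.scaleR_left blinfun_compose.scaleR_right)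

lemma blinfun_pow_commute:
  assumes "C o\<^sub>L B = B o\<^sub>L C"
  shows "C o\<^sub>L blinfun_pow B n = blinfun_pow B n o\<^sub>L C"
proof (induction n)
  case (Suc n)
  have "C o\<^sub>L blinfun_pow B (Suc n) = B o\<^sub>L (C o\<^sub>L blinfun_pow B n)"
    by (simp add: blinfun_pow_Suc assms flip: blinfun_compose_assoc)
  then show ?case by (simp add: Suc blinfun_pow_Suc blinfun_compose_assoc)
qed auto

lemma norm_blinfun_exp_term: "norm ((1 / fact n) *\<^sub>R blinfun_pow B n) \<le> norm B ^ n /\<^sub>R fact n"
  using norm_blinfun_pow[of B n] by (simp add: divide_simps)

lemma summable_norm_blinfun_exp: "summable (\<lambda>n. norm ((1 / fact n) *\<^sub>R blinfun_pow B n))"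
  by (rule summable_comparison_test'[OF summable_exp_generic[of "norm B"]])
    (use norm_blinfun_exp_term in auto)

lemma blinfun_exp_sums:
  fixes B :: "'a::banach \<Rightarrow>\<^sub>L 'a"
  shows "(\<lambda>n. (1 / fact n) *\<^sub>R blinfun_pow B n) sums blinfun_exp B"
  unfolding blinfun_exp_def
  by (rule summable_sums[OF summable_norm_cancel[OF summable_norm_blinfun_exp]])

lemma blinfun_exp_0 [simp]: "blinfun_exp (0 :: 'a::banach \<Rightarrow>\<^sub>L 'a) = id_blinfun"
proof -
  have *: "(\<lambda>n. (1 / fact n) *\<^sub>R blinfun_pow (0 :: 'a \<Rightarrow>\<^sub>L 'a) n) = (\<lambda>n. if n = 0 then id_blinfun else 0)"
  proof
    fix n show "(1 / fact n) *\<^sub>R blinfun_pow (0 :: 'a \<Rightarrow>\<^sub>L 'a) n = (if n = 0 then id_blinfun else 0)"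
      by (cases n) (auto simp: blinfun_pow_Suc)
  qed
  have "(\<lambda>n. (1 / fact n) *\<^sub>R blinfun_pow (0 :: 'a \<Rightarrow>\<^sub>L 'a) n) sums id_blinfun"
    unfolding * by (rule sums_single)
  then show ?thesis using blinfun_exp_sums sums_unique2 by blast
qed

lemma norm_blinfun_exp:
  fixes B :: "'a::banach \<Rightarrow>\<^sub>L 'a"
  shows "norm (blinfun_exp B) \<le> exp (norm B)"
proof -
  have "norm (blinfun_exp B) \<le> (\<Sum>n. norm ((1 / fact n) *\<^sub>R blinfun_pow B n))"
    unfolding blinfun_exp_def by (rule summable_norm[OF summable_norm_blinfun_exp])
  also have "\<dots> \<le> (\<Sum>n. norm B ^ n /\<^sub>R fact n)"
    by (intro suminf_le norm_blinfun_exp_term summable_norm_blinfun_exp summable_exp_generic)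
  finally show ?thesis by (simp add: exp_def)
qed

lemma blinfun_exp_commute:
  fixes B :: "'a::banach \<Rightarrow>\<^sub>L 'a"
  assumes "C o\<^sub>L B = B o\<^sub>L C"
  shows "C o\<^sub>L blinfun_exp B = blinfun_exp B o\<^sub>L C"
proof -
  have "(\<lambda>n. C o\<^sub>L ((1 / fact n) *\<^sub>R blinfun_pow B n)) sums (C o\<^sub>L blinfun_exp B)"
    by (rule blinfun_compose.bounded_linear_right[THEN bounded_linear.sums, OF blinfun_exp_sums])
  moreover have "(\<lambda>n. ((1 / fact n) *\<^sub>R blinfun_pow B n) o\<^sub>L C) sums (blinfun_exp B o\<^sub>L C)"
    by (rule blinfun_compose.bounded_linear_left[THEN bounded_linear.sums, OF blinfun_exp_sums])
  ultimately show ?thesis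
    by (simp add: blinfun_compose.scaleR_left blinfun_compose.scaleR_right
        blinfun_pow_commute[OF assms] sums_unique2)
qed

lemma uniform_limit_blinfun_exp:
  fixes B :: "'a::banach \<Rightarrow>\<^sub>L 'a"
  shows "uniform_limit {-r..r} (\<lambda>n t. \<Sum>i<n. (t ^ i / fact i) *\<^sub>R blinfun_pow B i)
           (\<lambda>t. blinfun_exp (t *\<^sub>R B)) sequentially"
proof -
  have "uniform_limit {-r..r} (\<lambda>n t. \<Sum>i<n. (t ^ i / fact i) *\<^sub>R blinfun_pow B i)
           (\<lambda>t. \<Sum>i. (t ^ i / fact i) *\<^sub>R blinfun_pow B i) sequentially"
  proof (rule Weierstrass_m_test)
    show "summable (\<lambda>n. (\<bar>r\<bar> * norm B) ^ n /\<^sub>R fact n)" by (rule summable_exp_generic)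
    fix n t assume "t \<in> {-r..r}"
    then have "\<bar>t\<bar> ^ n * norm (blinfun_pow B n) \<le> \<bar>r\<bar> ^ n * norm B ^ n"
      by (intro mult_mono power_mono norm_blinfun_pow) auto
    then show "norm ((t ^ n / fact n) *\<^sub>R blinfun_pow B n) \<le> (\<bar>r\<bar> * norm B) ^ n /\<^sub>R fact n"
      by (simp add: divide_simps power_mult_distrib power_abs)
  qed
  then show ?thesis
    by (simp add: blinfun_exp_def blinfun_pow_scaleR)
qed

lemma blinfun_exp_scaleR_has_vector_derivative:
  fixes B :: "'a::banach \<Rightarrow>\<^sub>L 'a"
  shows "((\<lambda>t. blinfun_exp (t *\<^sub>R B)) has_vector_derivative (B o\<^sub>L blinfun_exp (t *\<^sub>R B))) (at t within S)"
proof -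
  \<comment> \<open>One unit of room keeps t in the interior of {-r..r}, so the derivative within
    the interval is a two-sided one.\<close>
  define r where "r = \<bar>t\<bar> + 1"
  define f where "f = (\<lambda>n t. (t ^ n / fact n) *\<^sub>R blinfun_pow B n)"
  define f' where "f' = (\<lambda>n t. (real n * t ^ (n - 1) / fact n) *\<^sub>R blinfun_pow B n)"
  \<comment> \<open>The zeroth differentiated term vanishes, hence the shift by one between the
    partial sums of \<open>f'\<close> and those of \<open>f\<close>.\<close>
  have f'_Suc: "(\<Sum>i<Suc n. f' i x) = B o\<^sub>L (\<Sum>i<n. f i x)" for n x
  proof -
    have "f' (Suc i) x = B o\<^sub>L f i x" for i
      by (simp add: f_def f'_def blinfun_pow_Suc blinfun_compose.scaleR_right)
    then show ?thesis
      by (simp add: sum.lessThan_Suc_shift blinfun_compose.sum_right del: sum.lessThan_Suc)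
        (simp add: f'_def)
  qed
  have "uniform_limit {-r..r} (\<lambda>n x. B o\<^sub>L (\<Sum>i<n. f i x)) (\<lambda>x. B o\<^sub>L blinfun_exp (x *\<^sub>R B)) sequentially"
    unfolding f_def
    by (rule blinfun_compose.bounded_linear_right[THEN bounded_linear.uniform_limit, OF uniform_limit_blinfun_exp])
  then have "uniform_limit {-r..r} (\<lambda>n x. \<Sum>i<Suc n. f' i x) (\<lambda>x. B o\<^sub>L blinfun_exp (x *\<^sub>R B)) sequentially"
    unfolding f'_Suc .
  then have ul: "\<forall>\<^sub>F n in sequentially. \<forall>x\<in>{-r..r}. dist (\<Sum>i<n. f' i x) (B o\<^sub>L blinfun_exp (x *\<^sub>R B)) < e"
    if "e > 0" for e
    using that unfolding uniform_limit_iff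
    by (subst eventually_sequentially_Suc[symmetric]) blast
  have "\<exists>g. \<forall>x\<in>{-r..r}. (\<lambda>n. f n x) sums g x \<and>
      (g has_derivative (\<lambda>h. h *\<^sub>R (B o\<^sub>L blinfun_exp (x *\<^sub>R B)))) (at x within {-r..r})"
  proof (rule has_derivative_series)
    show "(f n has_derivative (\<lambda>h. h *\<^sub>R f' n x)) (at x within {-r..r})" for n x
    proof -
      have "((\<lambda>t. t ^ n / fact n) has_real_derivative real n * x ^ (n - 1) / fact n) (at x within {-r..r})"
        by (auto intro!: derivative_eq_intros)
      from has_vector_derivative_scaleR[OF this has_vector_derivative_const]
      have "(f n has_vector_derivative f' n x) (at x within {-r..r})"
        by (simp add: f_def f'_def)
      then show ?thesis by (simp add: has_vector_derivative_def)
    qed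
    show "\<forall>\<^sub>F n in sequentially. \<forall>x\<in>{-r..r}. \<forall>h.
        norm ((\<Sum>i<n. h *\<^sub>R f' i x) - h *\<^sub>R (B o\<^sub>L blinfun_exp (x *\<^sub>R B))) \<le> e * norm h"
      if "e > 0" for e
      using ul[OF that]
    proof eventually_elim
      case (elim n)
      show ?case
      proof (intro ballI allI)
        fix x h assume "x \<in> {-r..r}"
        then have "norm ((\<Sum>i<n. f' i x) - (B o\<^sub>L blinfun_exp (x *\<^sub>R B))) \<le> e"
          using elim by (auto simp: dist_norm intro: less_imp_le)
        then have "\<bar>h\<bar> * norm ((\<Sum>i<n. f' i x) - (B o\<^sub>L blinfun_exp (x *\<^sub>R B))) \<le> \<bar>h\<bar> * e"
          by (intro mult_left_mono) auto
        then show "norm ((\<Sum>i<n. h *\<^sub>R f' i x) - h *\<^sub>R (B o\<^sub>L blinfun_exp (x *\<^sub>R B))) \<le> e * norm h"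
          by (simp add: mult.commute flip: scaleR_diff_right scaleR_sum_right)
      qed
    qed
    show "0 \<in> {-r..r}" by (simp add: r_def)
    show "(\<lambda>n. f n 0) sums blinfun_exp (0 *\<^sub>R B)"
      using blinfun_exp_sums[of "0 *\<^sub>R B"]
      unfolding f_def blinfun_pow_scaleR by (simp add: mult.commute)
  qed auto
  then obtain g where g0: "\<forall>x\<in>{-r..r}. (\<lambda>n. f n x) sums g x \<and>
      (g has_vector_derivative (B o\<^sub>L blinfun_exp (x *\<^sub>R B))) (at x within {-r..r})"
    unfolding has_vector_derivative_def by blast
  then have g: "(\<lambda>n. f n x) sums g x"
    "(g has_vector_derivative (B o\<^sub>L blinfun_exp (x *\<^sub>R B))) (at x within {-r..r})" if "x \<in> {-r..r}" for x
    using that by blast+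
  have eq: "g x = blinfun_exp (x *\<^sub>R B)" if "x \<in> {-r..r}" for x
    using g(1)[OF that] blinfun_exp_sums[of "x *\<^sub>R B"]
    by (simp add: f_def blinfun_pow_scaleR sums_unique2)
  have "(g has_vector_derivative (B o\<^sub>L blinfun_exp (t *\<^sub>R B))) (at t)"
  proof -
    have "-r < t" "t < r" by (auto simp: r_def)
    then show ?thesis using g(2)[of t] at_within_Icc_at[of "-r" t r] by auto
  qed
  then have "((\<lambda>t. blinfun_exp (t *\<^sub>R B)) has_vector_derivative (B o\<^sub>L blinfun_exp (t *\<^sub>R B))) (at t)"
    by (rule has_vector_derivative_transform_within_open[of _ _ _ "{-r<..<r}"])
      (auto simp: r_def intro!: eq)
  then show ?thesis by (rule has_vector_derivative_at_within)
qed

lemma blinfun_exp_minus: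
  fixes B :: "'a::banach \<Rightarrow>\<^sub>L 'a"
  shows "blinfun_exp (- (t *\<^sub>R B)) o\<^sub>L blinfun_exp (t *\<^sub>R B) = id_blinfun"
proof -
  let ?f = "\<lambda>t. blinfun_exp (t *\<^sub>R (- B)) o\<^sub>L blinfun_exp (t *\<^sub>R B)"
  have "(?f has_vector_derivative 0) (at s)" for s
  proof -
    have "(?f has_vector_derivative
       (blinfun_exp (s *\<^sub>R (- B)) o\<^sub>L (B o\<^sub>L blinfun_exp (s *\<^sub>R B))) +
       (((- B) o\<^sub>L blinfun_exp (s *\<^sub>R (- B))) o\<^sub>L blinfun_exp (s *\<^sub>R B))) (at s)"
      by (rule bounded_bilinear.has_vector_derivative[OF bounded_bilinear_blinfun_compose blinfun_exp_scaleR_has_vector_derivative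
            blinfun_exp_scaleR_has_vector_derivative])
    moreover have "B o\<^sub>L blinfun_exp (s *\<^sub>R (- B)) = blinfun_exp (s *\<^sub>R (- B)) o\<^sub>L B"
      by (rule blinfun_exp_commute)
        (simp add: blinfun_compose.scaleR_left blinfun_compose.scaleR_right
          blinfun_compose.minus_left blinfun_compose.minus_right)
    ultimately show ?thesis
      by (simp add: blinfun_compose_assoc[symmetric] blinfun_compose.minus_left)
  qed
  then obtain c where "?f s = c" for s
    using has_vector_derivative_zero_constant[of UNIV ?f] by auto
  then have "?f t = ?f 0" by metis
  then show ?thesis by simp
qed

text \<open>Multiplying a solution by exp(-tB) gives a function with derivative 0. Uniqueness then
  yields the functional equation of the exponential.\<close>

lemma blinfun_ode_unique:
  fixes B :: "'a::banach \<Rightarrow>\<^sub>L 'a"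
  assumes Y: "\<And>t. (Y has_vector_derivative (B o\<^sub>L Y t)) (at t)" and 0: "Y 0 = id_blinfun"
  shows "Y t = blinfun_exp (t *\<^sub>R B)"
proof -
  let ?f = "\<lambda>t. blinfun_exp (t *\<^sub>R (- B)) o\<^sub>L Y t"
  have "(?f has_vector_derivative 0) (at s)" for s
  proof -
    have "(?f has_vector_derivative
       (blinfun_exp (s *\<^sub>R (- B)) o\<^sub>L (B o\<^sub>L Y s)) +
       (((- B) o\<^sub>L blinfun_exp (s *\<^sub>R (- B))) o\<^sub>L Y s)) (at s)"
      by (rule bounded_bilinear.has_vector_derivative[OF bounded_bilinear_blinfun_compose blinfun_exp_scaleR_has_vector_derivative Y])
    moreover have "B o\<^sub>L blinfun_exp (s *\<^sub>R (- B)) = blinfun_exp (s *\<^sub>R (- B)) o\<^sub>L B"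
      by (rule blinfun_exp_commute)
        (simp add: blinfun_compose.scaleR_left blinfun_compose.scaleR_right
          blinfun_compose.minus_left blinfun_compose.minus_right)
    ultimately show ?thesis
      by (simp add: blinfun_compose_assoc[symmetric] blinfun_compose.minus_left)
  qed
  then obtain c where "?f s = c" for s
    using has_vector_derivative_zero_constant[of UNIV ?f] by auto
  then have "?f t = ?f 0" by metis
  then have *: "blinfun_exp (- (t *\<^sub>R B)) o\<^sub>L Y t = id_blinfun" using 0 by simp
  have "blinfun_exp (t *\<^sub>R B) o\<^sub>L (blinfun_exp (- (t *\<^sub>R B)) o\<^sub>L Y t) = Y t"
    using blinfun_exp_minus[of "-t" B] by (simp flip: blinfun_compose_assoc)
  then show ?thesis by (simp add: *)
qed

lemma blinfun_exp_add:
  fixes B C :: "'a::banach \<Rightarrow>\<^sub>L 'a"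
  assumes "B o\<^sub>L C = C o\<^sub>L B"
  shows "blinfun_exp (B + C) = blinfun_exp B o\<^sub>L blinfun_exp C"
proof -
  let ?Y = "\<lambda>t. blinfun_exp (t *\<^sub>R B) o\<^sub>L blinfun_exp (t *\<^sub>R C)"
  have "(?Y has_vector_derivative ((B + C) o\<^sub>L ?Y t)) (at t)" for t
  proof -
    have "(?Y has_vector_derivative
       (blinfun_exp (t *\<^sub>R B) o\<^sub>L (C o\<^sub>L blinfun_exp (t *\<^sub>R C))) +
       ((B o\<^sub>L blinfun_exp (t *\<^sub>R B)) o\<^sub>L blinfun_exp (t *\<^sub>R C))) (at t)"
      by (rule bounded_bilinear.has_vector_derivative[OF bounded_bilinear_blinfun_compose blinfun_exp_scaleR_has_vector_derivative
            blinfun_exp_scaleR_has_vector_derivative])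
    moreover have "C o\<^sub>L blinfun_exp (t *\<^sub>R B) = blinfun_exp (t *\<^sub>R B) o\<^sub>L C"
      by (rule blinfun_exp_commute)
        (simp add: assms blinfun_compose.scaleR_left blinfun_compose.scaleR_right)
    ultimately show ?thesis
      by (simp add: blinfun_compose_assoc[symmetric] blinfun_compose.add_left add.commute)
  qed
  from blinfun_ode_unique[of ?Y "B + C" 1, OF this] show ?thesis by simp
qed

section \<open>Differentiating the exponential along commuting families\<close>

lemma blinfun_exp_has_derivative_0:
  "(blinfun_exp has_derivative (\<lambda>E. E)) (at (0 :: 'a::banach \<Rightarrow>\<^sub>L 'a))"
proof -
  \<comment> \<open>The series without its first two terms is dominated termwise by the scalar
    series at \<open>norm E\<close>, which reduces the claim to the real exponential.\<close>
  have bound: "norm (blinfun_exp E - id_blinfun - E) \<le> exp (norm E) - 1 - norm E" for E :: "'a \<Rightarrow>\<^sub>L 'a"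
  proof -
    let ?f = "\<lambda>n. (1 / fact n) *\<^sub>R blinfun_pow E n"
    let ?g = "\<lambda>n. norm E ^ n /\<^sub>R fact n"
    have s: "(\<lambda>n. ?f (n + 2)) sums (blinfun_exp E - (id_blinfun + E))"
      using sums_split_initial_segment[OF blinfun_exp_sums[of E], of 2]
      by (simp add: numeral_2_eq_2 blinfun_pow_Suc)
    have g: "(\<lambda>n. ?g (n + 2)) sums (exp (norm E) - (1 + norm E))"
      using sums_split_initial_segment[OF exp_converges[of "norm E"], of 2]
      by (simp add: numeral_2_eq_2)
    have "norm (blinfun_exp E - (id_blinfun + E)) \<le> exp (norm E) - (1 + norm E)"
      by (rule norm_sums_le[OF s g norm_blinfun_exp_term])
    then show ?thesis by (simp add: algebra_simps)
  qed
  have "((\<lambda>r. (exp r - 1) / r - 1) \<longlongrightarrow> 0) (at (0::real))"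
    using DERIV_exp[of "0::real"] by (auto simp: has_field_derivative_iff intro: LIM_zero)
  then have lim: "((\<lambda>r. (exp r - 1 - r) / r) \<longlongrightarrow> 0) (at (0::real))"
    by (rule Lim_transform_eventually) (auto simp: eventually_at field_simps intro!: exI[of _ 1])
  have n: "filterlim (\<lambda>E :: 'a \<Rightarrow>\<^sub>L 'a. norm E) (at 0) (at 0)"
    unfolding filterlim_at by (auto simp: eventually_at intro!: tendsto_eq_intros exI[of _ 1])
  have "((\<lambda>E :: 'a \<Rightarrow>\<^sub>L 'a. norm (blinfun_exp E - id_blinfun - E) / norm E) \<longlongrightarrow> 0) (at 0)"
    by (rule tendsto_sandwich[OF _ _ tendsto_const filterlim_compose[OF lim n]])
      (auto intro!: always_eventually divide_right_mono bound)
  then show ?thesis unfolding has_derivative_at by simp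
qed

text \<open>By commutativity exp(C r) = exp(C s) exp(C r - C s), so only the derivative at the zero
  operator is needed. This will be applied to \<xi> as the variable, where the operator does not
  move along a line.\<close>

lemma blinfun_exp_has_vector_derivative:
  fixes C :: "real \<Rightarrow> 'a::banach \<Rightarrow>\<^sub>L 'a"
  assumes "(C has_vector_derivative C') (at s within S)"
    and comm: "\<And>r. r \<in> S \<Longrightarrow> C r o\<^sub>L C s = C s o\<^sub>L C r" and "s \<in> S"
  shows "((\<lambda>r. blinfun_exp (C r)) has_vector_derivative (blinfun_exp (C s) o\<^sub>L C')) (at s within S)"
proof -
  have "((\<lambda>r. C r - C s) has_derivative (\<lambda>h. h *\<^sub>R C')) (at s within S)"
    using assms(1) unfolding has_vector_derivative_def by (auto intro!: derivative_eq_intros)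
  then have "((\<lambda>r. blinfun_exp (C r - C s)) has_derivative (\<lambda>h. h *\<^sub>R C')) (at s within S)"
    by (rule has_derivative_compose) (simp add: blinfun_exp_has_derivative_0)
  then have "((\<lambda>r. blinfun_exp (C r - C s)) has_vector_derivative C') (at s within S)"
    by (simp add: has_vector_derivative_def)
  then have "((\<lambda>r. blinfun_exp (C s) o\<^sub>L blinfun_exp (C r - C s)) has_vector_derivative
      (blinfun_exp (C s) o\<^sub>L C')) (at s within S)"
    by (rule bounded_linear.has_vector_derivative[OF blinfun_compose.bounded_linear_right])
  moreover have "blinfun_exp (C s) o\<^sub>L blinfun_exp (C r - C s) = blinfun_exp (C r)" if "r \<in> S" for r
    by (subst blinfun_exp_add[symmetric])
      (auto simp: comm[OF that] blinfun_compose.diff_left blinfun_compose.diff_right)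
  ultimately show ?thesis
    using has_vector_derivative_transform[OF \<open>s \<in> S\<close>] by (metis (no_types, lifting))
qed

section \<open>Improper Henstock-Kurzweil integrals\<close>

text \<open>The derivative is asked for at positive points only, because the weights s^(a-1) are
  singular at 0 when a < 1; continuity of F covers the endpoint.\<close>

lemma has_integral_improper_FTC:
  fixes F :: "real \<Rightarrow> 'b::banach"
  assumes cont: "continuous_on {0..} F"
    and deriv: "\<And>s. s > 0 \<Longrightarrow> (F has_vector_derivative f s) (at s)"
    and lim: "(F \<longlongrightarrow> L) at_top"
  shows "(f has_integral (L - F 0)) {0<..}"
proof -
  \<comment> \<open>\<open>has_integral_alt\<close> treats boxes separately; the half-line is
    unbounded, so the definition by exhaustion with large boxes applies.\<close>
  have ncbox: "\<not> (\<exists>a b. {0<..} = cbox a (b::real))"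
  proof safe
    fix a b :: real assume eq: "{0<..} = cbox a b"
    have "max 1 (b + 1) \<in> {0::real<..}" by simp
    then show False unfolding eq by simp
  qed
  have "\<exists>B>0. \<forall>a b. ball 0 B \<subseteq> cbox a b \<longrightarrow>
      (\<exists>z. ((\<lambda>x. if x \<in> {0<..} then f x else 0) has_integral z) (cbox a b) \<and> norm (z - (L - F 0)) < e)"
    if "e > 0" for e
  proof -
    from lim \<open>e > 0\<close> obtain N where N: "\<And>s. s \<ge> N \<Longrightarrow> dist (F s) L < e"
      by (auto simp: tendsto_iff eventually_at_top_linorder)
    show ?thesis
    proof (intro exI[of _ "max N 1"] conjI allI impI)
      fix a b :: real assume sub: "ball 0 (max N 1) \<subseteq> cbox a b"
      then have "cball 0 (max N 1) \<subseteq> cbox a b"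
        by (metis closed_cbox closure_ball closure_minimal less_max_iff_disj zero_less_one less_irrefl)
      moreover have "\<bar>max N 1\<bar> \<le> max N 1" "\<bar>- max N 1\<bar> \<le> max N 1" by auto
      ultimately have "max N 1 \<in> cbox a b" "- max N 1 \<in> cbox a b"
        by (metis (no_types) subset_iff mem_cball_0 real_norm_def)+
      then have ab: "a \<le> 0" "0 \<le> b" "N \<le> b" by auto
      let ?g = "\<lambda>x. if x \<in> {0<..} then f x else 0"
      have "(f has_integral (F b - F 0)) {0..b}"
        by (rule fundamental_theorem_of_calculus_interior)
          (use ab deriv in \<open>auto intro: continuous_on_subset[OF cont]\<close>)
      then have 1: "(?g has_integral (F b - F 0)) {0..b}"
        by (rule has_integral_spike_finite[of "{0}", rotated 2]) auto
      have 2: "(?g has_integral 0) {a..0}"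
        by (rule has_integral_is_0) auto
      from has_integral_combine[OF ab(1,2) 2 1]
      have "(?g has_integral (F b - F 0)) (cbox a b)" by simp
      moreover have "norm ((F b - F 0) - (L - F 0)) < e"
        using N[OF ab(3)] by (simp add: dist_norm)
      ultimately show "\<exists>z. (?g has_integral z) (cbox a b) \<and> norm (z - (L - F 0)) < e" by blast
    qed auto
  qed
  then show ?thesis
    using ncbox by (subst has_integral_alt) auto
qed

lemma convergent_if_dominated_increments:
  fixes F :: "'c \<Rightarrow> 'b::{banach}" and G :: "'c \<Rightarrow> real"
  assumes G: "(G \<longlongrightarrow> l) A" and P: "eventually P A" and A: "A \<noteq> bot"
    and le: "\<And>x y. P x \<Longrightarrow> P y \<Longrightarrow> norm (F x - F y) \<le> \<bar>G x - G y\<bar>"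
  shows "\<exists>L. (F \<longlongrightarrow> L) A"
proof -
  have "cauchy_filter (filtermap F A)"
    unfolding cauchy_filter_metric_filtermap
  proof (intro allI impI)
    fix e :: real assume "e > 0"
    then have "eventually (\<lambda>x. dist (G x) l < e / 2) A"
      by (intro tendstoD[OF G]) simp
    then have "eventually (\<lambda>x. P x \<and> dist (G x) l < e / 2) A"
      using P by eventually_elim auto
    moreover have "dist (F x) (F y) < e"
      if "P x \<and> dist (G x) l < e / 2" "P y \<and> dist (G y) l < e / 2" for x y
    proof -
      have "dist (F x) (F y) \<le> \<bar>G x - G y\<bar>" using le that by (simp add: dist_norm)
      also have "\<dots> < e" using that by (auto simp: dist_real_def abs_if split: if_splits)
      finally show ?thesis .
    qed
    ultimately show "\<exists>P. eventually P A \<and> (\<forall>x y. P x \<and> P y \<longrightarrow> dist (F x) (F y) < e)"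
      by blast
  qed
  then obtain L where "filtermap F A \<le> nhds L"
    using cauchy_filter_complete_converges[of "filtermap F A" UNIV] complete_UNIV A
    by (auto simp: filtermap_bot_iff)
  then show ?thesis by (auto simp: filterlim_def)
qed

text \<open>Domination for Banach-valued integrands, obtained through a primitive: the increments of
  F are bounded by those of the monotone bounded function G, so F is Cauchy both at 0 and at
  infinity, and the improper fundamental theorem gives the integral.\<close>

lemma integrable_dominated_antiderivative:
  fixes f :: "real \<Rightarrow> 'b::banach"
  assumes cont: "continuous_on {0<..} f" and g: "g integrable_on {0<..}"
    and le: "\<And>s. s > 0 \<Longrightarrow> norm (f s) \<le> g s"
  obtains F where "continuous_on {0..} F" "F 0 = 0"
    "\<And>s. s > 0 \<Longrightarrow> (F has_vector_derivative f s) (at s)"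
    "(F \<longlongrightarrow> integral {0<..} f) at_top" "f integrable_on {0<..}"
proof -
  have gpos: "0 \<le> g s" if "s > 0" for s using le[OF that] norm_ge_zero order_trans by blast
  define g' where "g' = (\<lambda>s. if s \<in> {0<..} then g s else 0)"
  have g'_int: "g' integrable_on {0..}"
  proof -
    have "g' integrable_on {0<..}" using g by (rule integrable_eq) (auto simp: g'_def)
    then show ?thesis
      by (rule integrable_spike_set[OF _ negligible_subset[of "{0}"]]) (auto simp: g'_def)
  qed
  have g'_pos: "0 \<le> g' s" for s using gpos by (auto simp: g'_def)
  have g'_sub: "g' integrable_on {a..b}" if "0 \<le> a" for a b
    by (rule integrable_on_subinterval[OF g'_int]) (use that in auto)
  define G where "G = (\<lambda>s. integral {0..s} g')"
  have G_diff: "integral {a..b} g' = G b - G a" if "0 \<le> a" "a \<le> b" for a b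
    using Henstock_Kurzweil_Integration.integral_combine[of 0 a b g'] that g'_sub[of 0 b]
    by (simp add: G_def)
  have G_mono: "G a \<le> G b" if "0 \<le> a" "a \<le> b" for a b
    using G_diff[OF that] integral_nonneg[OF g'_sub[OF that(1), of b]] g'_pos by simp
  have G_le: "G b \<le> integral {0..} g'" for b
    unfolding G_def by (rule integral_subset_le) (use g'_int g'_sub g'_pos in auto)
  have G_cont: "continuous_on {0..1} G"
    unfolding G_def by (rule indefinite_integral_continuous_1[OF g'_sub]) simp
  have G_0: "(G \<longlongrightarrow> G 0) (at_right 0)"
    using G_cont by (auto simp: continuous_on at_within_Icc_at_right dest!: bspec[of _ _ 0])
  have G_top: "\<exists>l. (G \<longlongrightarrow> l) at_top"
  proof -
    let ?l = "SUP s\<in>{0..}. G s"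
    have bdd: "bdd_above (G ` {0..})" using G_le by (auto intro!: bdd_aboveI)
    have "(G \<longlongrightarrow> ?l) at_top"
    proof (rule increasing_tendsto)
      show "\<forall>\<^sub>F s in at_top. G s \<le> ?l"
        using eventually_ge_at_top[of 0] by eventually_elim (rule cSUP_upper[OF _ bdd], auto)
      fix x assume "x < ?l"
      then obtain s where s: "s \<ge> 0" "x < G s"
        using bdd by (subst (asm) less_cSUP_iff) auto
      show "\<forall>\<^sub>F n in at_top. x < G n"
        using eventually_ge_at_top[of s] by eventually_elim (use s G_mono in force)
    qed
    then show ?thesis by blast
  qed
  have f_int: "f integrable_on {a..b}" if "0 < a" for a b
    by (rule integrable_continuous_interval, rule continuous_on_subset[OF cont]) (use that in auto)
  \<comment> \<open>The base point is 1 because f need not be bounded near 0. \<open>F_eq\<close>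
    then moves the base point to any smaller positive a.\<close>
  define F where "F = (\<lambda>s. if 1 \<le> s then integral {1..s} f else - integral {s..1} f)"
  have F_eq: "F x = integral {a..x} f - integral {a..1} f" if "0 < a" "a \<le> 1" "a \<le> x" for a x
    using Henstock_Kurzweil_Integration.integral_combine[of a 1 x f]
      Henstock_Kurzweil_Integration.integral_combine[of a x 1 f] that f_int[of a]
    by (auto simp: F_def algebra_simps)
  have F_diff: "F b - F a = integral {a..b} f" if "0 < a" "a \<le> b" for a b
  proof -
    have "integral {min a 1..a} f + integral {a..b} f = integral {min a 1..b} f"
      by (rule Henstock_Kurzweil_Integration.integral_combine) (use that f_int[of "min a 1"] in auto)
    then show ?thesis
      using F_eq[of "min a 1" a] F_eq[of "min a 1" b] that by (simp flip: \<open>_ = integral {min a 1..b} f\<close>)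
  qed
  have F_deriv: "(F has_vector_derivative f s) (at s)" if "s > 0" for s
  proof -
    define a where "a = min (s / 2) 1"
    have a: "0 < a" "a \<le> 1" "a < s" using that by (auto simp: a_def)
    have "((\<lambda>x. integral {a..x} f) has_vector_derivative f s) (at s within {a..s+1})"
      by (rule integral_has_vector_derivative[OF continuous_on_subset[OF cont]]) (use a in auto)
    moreover have "at s within {a..s+1} = at s"
      using a by (intro at_within_Icc_at) auto
    ultimately have "((\<lambda>x. integral {a..x} f) has_vector_derivative f s) (at s)" by simp
    then have "((\<lambda>x. integral {a..x} f - integral {a..1} f) has_vector_derivative f s) (at s)"
      by (simp add: has_vector_derivative_diff_const)
    then show ?thesis
      by (rule has_vector_derivative_transform_within_open[of _ _ _ "{a<..}"]) (use a F_eq in auto)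
  qed
  have bound: "norm (F b - F a) \<le> \<bar>G b - G a\<bar>" if "0 < a" "a \<le> b" for a b
  proof -
    have "norm (integral {a..b} f) \<le> integral {a..b} g'"
      by (rule Henstock_Kurzweil_Integration.integral_norm_bound_integral) (use that f_int g'_sub le in \<open>auto simp: g'_def\<close>)
    then show ?thesis using F_diff[OF that] G_diff[of a b] that by auto
  qed
  have bound': "norm (F x - F y) \<le> \<bar>G x - G y\<bar>" if "0 < x" "0 < y" for x y
    using bound[of x y] bound[of y x] that by (cases "x \<le> y") (auto simp: norm_minus_commute)
  obtain L0 where L0: "(F \<longlongrightarrow> L0) (at_right 0)"
    using convergent_if_dominated_increments[OF G_0 eventually_at_right_less[of 0] _ bound'] by auto
  obtain L1 where L1: "(F \<longlongrightarrow> L1) at_top"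
  proof -
    from G_top obtain l where "(G \<longlongrightarrow> l) at_top" ..
    from convergent_if_dominated_increments[OF this eventually_gt_at_top[of 0] _ bound'] that
    show thesis by auto
  qed
  \<comment> \<open>Renormalised to start at 0 and extended continuously to that point by the limit
    \<open>L0\<close>.\<close>
  define H where "H = (\<lambda>s. if s = 0 then 0 else F s - L0)"
  have H_deriv: "(H has_vector_derivative f s) (at s)" if "s > 0" for s
    by (rule has_vector_derivative_transform_within_open[of "\<lambda>s. F s - L0" _ _ "{0<..}"])
      (use that F_deriv in \<open>auto simp: H_def has_vector_derivative_diff_const\<close>)
  have H_cont: "continuous_on {0..} H"
    unfolding continuous_on_eq_continuous_within
  proof
    fix s :: real assume "s \<in> {0..}"
    then consider "s = 0" | "s > 0" by force
    then show "continuous (at s within {0..}) H"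
    proof cases
      case 1
      have "((\<lambda>s. F s - L0) \<longlongrightarrow> 0) (at_right 0)" using L0 by (rule LIM_zero)
      then have "(H \<longlongrightarrow> 0) (at_right 0)"
        by (rule Lim_transform_eventually) (auto simp: H_def eventually_at_filter)
      then show ?thesis by (simp add: 1 continuous_within H_def at_within_Ici_at_right)
    next
      case 2
      then show ?thesis
        using H_deriv[OF 2] has_vector_derivative_continuous continuous_at_imp_continuous_at_within by blast
    qed
  qed
  have H_top: "(H \<longlongrightarrow> L1 - L0) at_top"
    by (rule Lim_transform_eventually[OF tendsto_diff[OF L1 tendsto_const[of L0]]])
      (use eventually_gt_at_top[of 0] in eventually_elim, auto simp: H_def)
  have "(f has_integral (L1 - L0 - H 0)) {0<..}"
    by (rule has_integral_improper_FTC[OF H_cont H_deriv H_top])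
  then have "integral {0<..} f = L1 - L0" "f integrable_on {0<..}"
    by (auto simp: H_def integral_unique)
  then show thesis
    using that[OF H_cont _ H_deriv] H_top by (simp add: H_def)
qed

lemma has_integral_powr_exp:
  fixes a w :: real
  assumes "a > 0" "w > 0"
  shows "((\<lambda>s. s powr (a - 1) * exp (- (w * s))) has_integral Gamma a / w powr a) {0<..}"
proof -
  let ?f = "\<lambda>s::real. s powr (a - 1) * exp (- s)"
  have "((\<lambda>s. s powr (a - 1) / exp s) has_integral Gamma a) {0..}"
    by (rule Gamma_integral_real[OF assms(1)])
  then have "((\<lambda>s. s powr (a - 1) / exp s) has_integral Gamma a) {0<..}"
    by (subst (asm) has_integral_spike_set_eq[of _ "{0<..}"]) (auto intro: negligible_subset[of "{0::real}"])
  then have f: "(?f has_integral Gamma a) {0<..}"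
    by (simp add: exp_minus divide_inverse)
  have "continuous_on {0<..} ?f" by (auto intro!: continuous_intros)
  then obtain F where F: "continuous_on {0..} F" "F 0 = 0"
    "\<And>s. s > 0 \<Longrightarrow> (F has_vector_derivative ?f s) (at s)"
    "(F \<longlongrightarrow> integral {0<..} ?f) at_top"
    by (rule integrable_dominated_antiderivative[OF _ has_integral_integrable[OF f]]) (auto simp: abs_mult)
  \<comment> \<open>The substitution s to w s is carried out on the primitive of the Gamma
    integrand.\<close>
  let ?G = "\<lambda>s. F (w * s) / w powr a"
  have "((\<lambda>s. s powr (a - 1) * exp (- (w * s))) has_integral (Gamma a / w powr a - ?G 0)) {0<..}"
  proof (rule has_integral_improper_FTC)
    show "continuous_on {0..} ?G"
      by (intro continuous_intros continuous_on_compose2[OF F(1)]) (use assms in auto)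
    have "filterlim (\<lambda>s. w * s) at_top at_top"
      by (rule filterlim_tendsto_pos_mult_at_top[OF tendsto_const \<open>w > 0\<close> filterlim_ident])
    from filterlim_compose[OF F(4) this]
    show "(?G \<longlongrightarrow> Gamma a / w powr a) at_top"
      using integral_unique[OF f] assms by (intro tendsto_intros) auto
    fix s :: real assume s: "s > 0"
    then have "(F has_real_derivative ?f (w * s)) (at (w * s))"
      using F(3) assms by (simp add: has_real_derivative_iff_has_vector_derivative)
    then have "((\<lambda>s. F (w * s)) has_real_derivative ?f (w * s) * w) (at s)"
      by (rule DERIV_chain2) (auto intro!: derivative_eq_intros)
    then have "(?G has_real_derivative ?f (w * s) * w / w powr a) (at s)"
      by (rule DERIV_cdivide)
    moreover have "?f (w * s) * w / w powr a = s powr (a - 1) * exp (- (w * s))"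
      using s assms by (simp add: powr_mult powr_diff field_simps)
    ultimately show "(?G has_vector_derivative s powr (a - 1) * exp (- (w * s))) (at s)"
      by (simp add: has_real_derivative_iff_has_vector_derivative)
  qed
  then show ?thesis by (simp add: F(2))
qed

section \<open>Adjoints on a real Hilbert space\<close>

text \<open>The representing vector minimises \<open>y \<mapsto> y \<bullet> y - 2 * f y\<close>.\<close>
lemma riesz_representation:
  fixes f :: "'a::{real_inner, banach} \<Rightarrow> real"
  assumes "bounded_linear f"
  shows "\<exists>y. \<forall>x. f x = x \<bullet> y"
proof -
  interpret f: bounded_linear f by fact
  define q where "q = (\<lambda>y. y \<bullet> y - 2 * f y)"
  obtain K where K: "\<And>x. norm (f x) \<le> norm x * K" using f.bounded by blast
  \<comment> \<open>Completing the square: q y is at least (norm y - K)^2 - K^2.\<close>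
  have q_lower: "- K\<^sup>2 \<le> q y" for y
  proof -
    have "f y \<le> norm y * K" using K[of y] by simp
    moreover have "0 \<le> (norm y - K)\<^sup>2" by simp
    ultimately show ?thesis
      by (simp add: q_def power2_eq_square algebra_simps dot_square_norm)
  qed
  define m where "m = (INF y. q y)"
  have m_le: "m \<le> q y" for y
    unfolding m_def by (rule cINF_lower) (auto intro!: bdd_belowI q_lower)
  \<comment> \<open>The linear part of q cancels between y, z and their midpoint, leaving the
    parallelogram law. It makes every minimising sequence Cauchy.\<close>
  have par: "(dist y z)\<^sup>2 \<le> 2 * (q y - m) + 2 * (q z - m)" for y z
  proof -
    have "(dist y z)\<^sup>2 = 2 * q y + 2 * q z - 4 * q ((1/2) *\<^sub>R (y + z))"
      by (simp add: q_def dist_norm power2_norm_eq_inner inner_add inner_diff f.add f.scaleR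
          inner_commute algebra_simps)
    then show ?thesis using m_le[of "(1/2) *\<^sub>R (y + z)"] by simp
  qed
  have "\<exists>y. q y < m + 1 / Suc n" for n
  proof (rule ccontr)
    assume "\<nexists>y. q y < m + 1 / Suc n"
    then have "m + 1 / Suc n \<le> (INF y. q y)" by (intro cINF_greatest) (auto simp: not_less)
    then show False by (simp add: m_def)
  qed
  then obtain Y where Y: "\<And>n. q (Y n) < m + 1 / Suc n" by metis
  have "Cauchy Y"
  proof (rule metric_CauchyI)
    fix e :: real assume "e > 0"
    then have "e\<^sup>2 / 4 > 0" by simp
    then obtain N where N: "N > 0" "inverse (real N) < e\<^sup>2 / 4" using ex_inverse_of_nat_less by blast
    have *: "q (Y n) - m < e\<^sup>2 / 4" if "n \<ge> N" for n
    proof -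
      have "1 / real (Suc n) \<le> inverse (real N)" using that N by (simp add: divide_simps)
      then show ?thesis using Y[of n] N by linarith
    qed
    show "\<exists>M. \<forall>m\<ge>M. \<forall>n\<ge>M. dist (Y m) (Y n) < e"
    proof (intro exI[of _ N] allI impI)
      fix i j assume "N \<le> i" "N \<le> j"
      then have "(dist (Y i) (Y j))\<^sup>2 < e\<^sup>2" using par[of "Y i" "Y j"] *[of i] *[of j] by simp
      then show "dist (Y i) (Y j) < e" using \<open>e > 0\<close> by (auto intro: power_less_imp_less_base)
    qed
  qed
  then obtain y where y: "Y \<longlonglongrightarrow> y" using Cauchy_convergent convergent_def by blast
  have "(\<lambda>n. q (Y n)) \<longlonglongrightarrow> q y"
    unfolding q_def by (intro tendsto_intros y f.tendsto)
  moreover have "(\<lambda>n. m + 1 / real (Suc n)) \<longlonglongrightarrow> m + 0"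
    by (intro tendsto_intros LIMSEQ_Suc[OF lim_1_over_n])
  ultimately have "q y \<le> m + 0"
    by (rule LIMSEQ_le) (use Y less_imp_le in blast)
  then have min: "q y \<le> q z" for z using m_le[of z] by simp
  have "f x = x \<bullet> y" for x
  proof (rule ccontr)
    define d where "d = x \<bullet> y - f x"
    assume "f x \<noteq> x \<bullet> y"
    then have d: "d \<noteq> 0" by (simp add: d_def)
    have le: "0 \<le> 2 * r * d + r\<^sup>2 * (x \<bullet> x)" for r
      using min[of "y + r *\<^sub>R x"]
      by (simp add: q_def d_def inner_add f.add f.scaleR inner_commute power2_eq_square algebra_simps)
    show False
    \<comment> \<open>A minimiser has zero first variation: r = - d when the quadratic term is
      absent, and otherwise the vertex of the parabola, gives a negative value.\<close>
    proof (cases "x \<bullet> x = 0")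
      case True
      then show False using le[of "- d"] d by (simp add: not_le flip: power2_eq_square)
    next
      case False
      then have "x \<bullet> x > 0" by (metis inner_ge_zero order_le_less)
      moreover have "2 * (- d / (x \<bullet> x)) * d + (- d / (x \<bullet> x))\<^sup>2 * (x \<bullet> x) = - (d\<^sup>2 / (x \<bullet> x))"
        using False by (simp add: power2_eq_square field_simps)
      moreover have "d\<^sup>2 / (x \<bullet> x) > 0" using d \<open>x \<bullet> x > 0\<close> by (intro divide_pos_pos) auto
      ultimately show False
        using le[of "- d / (x \<bullet> x)"] by linarith
    qed
  qed
  then show ?thesis by blast
qed

definition adj :: "('a::{real_inner, banach} \<Rightarrow>\<^sub>L 'a) \<Rightarrow> ('a \<Rightarrow>\<^sub>L 'a)" where
  "adj C = Blinfun (\<lambda>y. SOME z. \<forall>x. C x \<bullet> y = x \<bullet> z)"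

lemma adj_ex: "\<exists>z. \<forall>x. blinfun_apply C x \<bullet> y = x \<bullet> z" for C :: "'a::{real_inner, banach} \<Rightarrow>\<^sub>L 'a"
  by (rule riesz_representation[of "\<lambda>x. C x \<bullet> y"])
    (intro bounded_linear_inner_left_comp blinfun.bounded_linear_right)


text \<open>The Riesz vector is unique, which makes its choice linear in y; testing with x = h y
  bounds it. Hence \<open>Blinfun\<close> receives a bounded linear map and not an arbitrary
  function.\<close>

lemma adj_inner: "blinfun_apply C x \<bullet> y = x \<bullet> adj C y"
proof -
  define h where "h = (\<lambda>y. SOME z. \<forall>x. blinfun_apply C x \<bullet> y = x \<bullet> z)"
  have h: "blinfun_apply C x \<bullet> y = x \<bullet> h y" for x y
    unfolding h_def using someI_ex[OF adj_ex[of C y]] by blast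
  have "bounded_linear h"
  proof (rule bounded_linear_intro)
    show "h (y + z) = h y + h z" for y z
      by (rule vector_eq_ldot[THEN iffD1]) (simp add: inner_add_right flip: h)
    show "h (r *\<^sub>R y) = r *\<^sub>R h y" for r y
      by (rule vector_eq_ldot[THEN iffD1]) (simp flip: h)
    show "norm (h y) \<le> norm y * norm C" for y
    proof -
      have "norm (h y) * norm (h y) = C (h y) \<bullet> y"
        unfolding h by (simp add: dot_square_norm power2_eq_square)
      also have "\<dots> \<le> norm (C (h y)) * norm y" by (rule norm_cauchy_schwarz)
      also have "\<dots> \<le> (norm C * norm (h y)) * norm y" by (intro mult_right_mono norm_blinfun) auto
      finally have "norm (h y) * norm (h y) \<le> (norm y * norm C) * norm (h y)" by (simp add: mult_ac)
      then show ?thesis by (cases "h y = 0") auto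
    qed
  qed
  moreover have "adj C = Blinfun h" by (simp add: adj_def h_def)
  ultimately show ?thesis by (simp add: h bounded_linear_Blinfun_apply)
qed

lemma norm_adj_le: "norm (adj C) \<le> norm C"
proof (rule norm_blinfun_bound)
  fix y
  have "norm (adj C y) * norm (adj C y) = C (adj C y) \<bullet> y"
    using adj_inner[of C "adj C y" y] by (simp add: dot_square_norm power2_eq_square)
  also have "\<dots> \<le> norm (C (adj C y)) * norm y" by (rule norm_cauchy_schwarz)
  also have "\<dots> \<le> (norm C * norm (adj C y)) * norm y" by (intro mult_right_mono norm_blinfun) auto
  finally have "norm (adj C y) * norm (adj C y) \<le> (norm C * norm y) * norm (adj C y)" by (simp add: mult_ac)
  then show "norm (adj C y) \<le> norm C * norm y" by (cases "adj C y = 0") auto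
qed auto

lemma adj_compose: "adj (C o\<^sub>L D) = adj D o\<^sub>L adj C"
  by (rule blinfun_eqI, rule vector_eq_ldot[THEN iffD1]) (simp flip: adj_inner)

text \<open>Continuity of \<open>adj\<close> in operator norm is what transports norm derivatives
  and norm continuity to adjoint families; strong limits would not pass.\<close>

lemma bounded_linear_adj: "bounded_linear adj"
proof (rule bounded_linear_intro)
  show "adj (C + D) = adj C + adj D" for C D :: "'a \<Rightarrow>\<^sub>L 'a"
    by (rule blinfun_eqI, rule vector_eq_ldot[THEN iffD1])
      (simp add: blinfun.add_left inner_add flip: adj_inner)
  show "adj (r *\<^sub>R C) = r *\<^sub>R adj C" for r and C :: "'a \<Rightarrow>\<^sub>L 'a"
    by (rule blinfun_eqI, rule vector_eq_ldot[THEN iffD1])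
      (simp add: blinfun.scaleR_left flip: adj_inner)
  show "norm (adj C) \<le> norm C * 1" for C :: "'a \<Rightarrow>\<^sub>L 'a" by (simp add: norm_adj_le)
qed

section \<open>Exponentially stable semigroups and their negative powers\<close>

lemma norm_diff_le_vector_derivative:
  fixes f :: "real \<Rightarrow> 'b::real_normed_vector"
  assumes "convex S" "\<And>x. x \<in> S \<Longrightarrow> (f has_vector_derivative f' x) (at x within S)"
    and "\<And>x. x \<in> S \<Longrightarrow> norm (f' x) \<le> B" "x \<in> S" "y \<in> S"
  shows "norm (f x - f y) \<le> B * \<bar>x - y\<bar>"
proof -
  have "onorm (\<lambda>h. h *\<^sub>R f' z) \<le> B" if "z \<in> S" for z
  proof (rule onorm_le)
    show "norm (h *\<^sub>R f' z) \<le> B * norm h" for h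
      using mult_right_mono[OF assms(3)[OF that], of "norm h"] by (simp add: mult.commute)
  qed
  then show ?thesis
    using differentiable_bound[OF assms(1) assms(2)[unfolded has_vector_derivative_def], of B x y] assms(4,5)
    by simp
qed

lemma has_vector_derivative_quadratic:
  fixes f :: "real \<Rightarrow> 'b::real_normed_vector"
  assumes "\<And>r. r \<in> S \<Longrightarrow> norm (f r - f s - (r - s) *\<^sub>R f') \<le> c * (r - s)\<^sup>2"
  shows "(f has_vector_derivative f') (at s within S)"
  unfolding has_vector_derivative_def has_derivative_within'
proof (intro conjI allI impI bounded_linear_scaleR_left)
  fix e :: real assume "e > 0"
  show "\<exists>d>0. \<forall>r\<in>S. 0 < norm (r - s) \<and> norm (r - s) < d \<longrightarrow>
      norm (f r - f s - (r - s) *\<^sub>R f') / norm (r - s) < e"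
  proof (intro exI[of _ "e / (\<bar>c\<bar> + 1)"] conjI ballI impI)
    fix r assume r: "r \<in> S" "0 < norm (r - s) \<and> norm (r - s) < e / (\<bar>c\<bar> + 1)"
    have "norm (f r - f s - (r - s) *\<^sub>R f') \<le> c * \<bar>r - s\<bar>\<^sup>2" using assms r by simp
    also have "\<dots> \<le> \<bar>c\<bar> * \<bar>r - s\<bar>\<^sup>2" by (intro mult_right_mono) auto
    finally have "norm (f r - f s - (r - s) *\<^sub>R f') / norm (r - s) \<le> \<bar>c\<bar> * \<bar>r - s\<bar>"
      using r by (simp add: divide_simps power2_eq_square mult_ac)
    also have "\<dots> \<le> \<bar>r - s\<bar> * (\<bar>c\<bar> + 1)" by (simp add: algebra_simps)
    also have "\<dots> < e" using r by (simp add: pos_less_divide_eq)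
    finally show "norm (f r - f s - (r - s) *\<^sub>R f') / norm (r - s) < e" .
  qed (use \<open>e > 0\<close> in auto)
qed

lemma powr_exp_tendsto_0:
  fixes a w :: real
  assumes "w > 0"
  shows "((\<lambda>s. s powr a * exp (- (w * s))) \<longlongrightarrow> 0) at_top"
proof -
  define n where "n = nat \<lceil>\<bar>a\<bar>\<rceil>"
  have lim: "((\<lambda>s. (w * s) ^ n / exp (w * s) / w ^ n) \<longlongrightarrow> 0 / w ^ n) at_top"
    by (intro tendsto_intros filterlim_compose[OF tendsto_power_div_exp_0]
        filterlim_tendsto_pos_mult_at_top[OF tendsto_const assms filterlim_ident]) (use assms in auto)
  show ?thesis
  proof (rule Lim_null_comparison)
    show "((\<lambda>s. (w * s) ^ n / exp (w * s) / w ^ n) \<longlongrightarrow> 0) at_top" using lim by simp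
    show "\<forall>\<^sub>F s in at_top. norm (s powr a * exp (- (w * s))) \<le> (w * s) ^ n / exp (w * s) / w ^ n"
      using eventually_ge_at_top[of 1]
    proof eventually_elim
      case (elim s)
      have "a \<le> real n" unfolding n_def by linarith
      then have "s powr a \<le> s powr real n" using elim by (intro powr_mono) auto
      then have "s powr a \<le> s ^ n" using elim by (simp add: powr_realpow)
      then show ?case using assms by (simp add: abs_mult exp_minus field_simps)
    qed
  qed
qed

text \<open>K and w are parameters rather than bound by an existential, so that every estimate can
  be reinstantiated for a shifted semigroup with the same K and a larger rate.\<close>

locale exp_stable_semigroup =
  fixes T :: "real \<Rightarrow> ('a::banach \<Rightarrow>\<^sub>L 'a)" and K w :: real
  assumes semigroup: "c0_semigroup T"
    and K_pos: "K > 0" and w_pos: "w > 0"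
    and norm_T_exp: "t \<ge> 0 \<Longrightarrow> norm (T t) \<le> K * exp (- (w * t))"
begin

lemma T_0 [simp]: "T 0 = id_blinfun"
  and T_add: "s \<ge> 0 \<Longrightarrow> t \<ge> 0 \<Longrightarrow> T (s + t) = T s o\<^sub>L T t"
  and T_tendsto: "((\<lambda>t. T t x) \<longlongrightarrow> x) (at_right 0)"
  using semigroup by (auto simp: c0_semigroup_def)

lemma T_commute: "s \<ge> 0 \<Longrightarrow> t \<ge> 0 \<Longrightarrow> T s o\<^sub>L T t = T t o\<^sub>L T s"
  by (metis T_add add.commute)

lemma norm_T_apply: "t \<ge> 0 \<Longrightarrow> norm (T t x) \<le> K * exp (- (w * t)) * norm x"
  by (rule order_trans[OF norm_blinfun mult_right_mono[OF norm_T_exp]]) auto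

lemma norm_T: "t \<ge> 0 \<Longrightarrow> norm (T t x) \<le> K * norm x"
  by (rule order_trans[OF norm_T_apply mult_right_mono]) (use K_pos w_pos in auto)

text \<open>From either side, the smaller of the two times is factored out, and the increment at 0
  over the distance remains; the factor costs at most K.\<close>

lemma T_continuous: "continuous_on {0..} (\<lambda>s. T s x)"
  unfolding continuous_on_def
proof
  fix s :: real assume "s \<in> {0..}"
  have "((\<lambda>d. K * norm (T d x - x)) \<longlongrightarrow> K * 0) (at_right 0)"
    by (intro tendsto_intros tendsto_norm_zero LIM_zero T_tendsto)
  moreover have "filterlim (\<lambda>r. \<bar>r - s\<bar>) (at_right 0) (at s within {0..})"
    unfolding filterlim_at by (auto simp: eventually_at_filter intro!: tendsto_eq_intros)
  ultimately have lim: "((\<lambda>r. K * norm (T \<bar>r - s\<bar> x - x)) \<longlongrightarrow> 0) (at s within {0..})"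
    by (auto dest: filterlim_compose)
  have "((\<lambda>r. T r x - T s x) \<longlongrightarrow> 0) (at s within {0..})"
  proof (rule Lim_null_comparison[OF _ lim])
    show "\<forall>\<^sub>F r in at s within {0..}. norm (T r x - T s x) \<le> K * norm (T \<bar>r - s\<bar> x - x)"
      unfolding eventually_at_filter
    proof (intro always_eventually allI impI)
      fix r :: real assume "r \<in> {0..}"
      show "norm (T r x - T s x) \<le> K * norm (T \<bar>r - s\<bar> x - x)"
      proof (cases "s \<le> r")
        case True
        have "T r x - T s x = T s (T \<bar>r - s\<bar> x - x)"
          using True \<open>s \<in> {0..}\<close> T_add[of s "r - s"] by (simp add: blinfun.diff_right)
        then show ?thesis using norm_T[of s] \<open>s \<in> {0..}\<close> by simp
      next
        case False
        have "T s x - T r x = T r (T \<bar>r - s\<bar> x - x)"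
          using False \<open>r \<in> {0..}\<close> T_add[of r "s - r"] by (simp add: blinfun.diff_right)
        then show ?thesis using norm_T[of r "T \<bar>r - s\<bar> x - x"] \<open>r \<in> {0..}\<close>
            by (simp add: norm_minus_commute[of "T r x"])
      qed
    qed
  qed
  then show "((\<lambda>s. T s x) \<longlongrightarrow> T s x) (at s within {0..})" by (rule LIM_zero_cancel)
qed

text \<open>The general weight \<phi> serves three purposes: the powers s^(a-1), the constant 1 when
  \<open>R\<close> is studied, and a Taylor remainder in the shift parameter.\<close>

lemma weight_dominated:
  assumes "a > 0" and \<phi>: "\<And>s. s > 0 \<Longrightarrow> \<bar>\<phi> s\<bar> \<le> c * s powr (a - 1)"
  shows "((\<lambda>s. c * K * norm x * (s powr (a - 1) * exp (- (w * s)))) has_integral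
            (c * K * norm x * (Gamma a / w powr a))) {0<..}"
    and "s > 0 \<Longrightarrow> norm (\<phi> s *\<^sub>R T s x) \<le> c * K * norm x * (s powr (a - 1) * exp (- (w * s)))"
proof -
  show "((\<lambda>s. c * K * norm x * (s powr (a - 1) * exp (- (w * s)))) has_integral
            (c * K * norm x * (Gamma a / w powr a))) {0<..}"
    by (rule has_integral_mult_right[OF has_integral_powr_exp[OF assms(1) w_pos]])
  assume s: "s > 0"
  have "norm (\<phi> s *\<^sub>R T s x) \<le> (c * s powr (a - 1)) * (K * exp (- (w * s)) * norm x)"
    unfolding norm_scaleR by (intro mult_mono \<phi> norm_T_apply) (use s \<phi>[OF s] in auto)
  then show "norm (\<phi> s *\<^sub>R T s x) \<le> c * K * norm x * (s powr (a - 1) * exp (- (w * s)))"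
    by (simp add: mult_ac)
qed

lemma weighted_antiderivative:
  assumes "a > 0" "\<And>s. s > 0 \<Longrightarrow> \<bar>\<phi> s\<bar> \<le> c * s powr (a - 1)" "continuous_on {0<..} \<phi>"
  obtains F where "continuous_on {0..} F" "F 0 = 0"
    "\<And>s. s > 0 \<Longrightarrow> (F has_vector_derivative \<phi> s *\<^sub>R T s x) (at s)"
    "(F \<longlongrightarrow> integral {0<..} (\<lambda>s. \<phi> s *\<^sub>R T s x)) at_top"
    "(\<lambda>s. \<phi> s *\<^sub>R T s x) integrable_on {0<..}"
proof -
  have 1: "continuous_on {0<..} (\<lambda>s. \<phi> s *\<^sub>R T s x)"
    by (intro continuous_intros assms continuous_on_subset[OF T_continuous]) auto
  have 2: "(\<lambda>s. c * K * norm x * (s powr (a - 1) * exp (- (w * s)))) integrable_on {0<..}"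
    by (rule has_integral_integrable[OF weight_dominated(1)[OF assms(1,2)]])
  have 3: "norm (\<phi> s *\<^sub>R T s x) \<le> c * K * norm x * (s powr (a - 1) * exp (- (w * s)))" if "s > 0" for s
    by (rule weight_dominated(2)[OF assms(1,2) that])
  show thesis by (rule integrable_dominated_antiderivative[OF 1 2 3 that])
qed

lemma norm_weighted_integral:
  assumes "a > 0" "\<And>s. s > 0 \<Longrightarrow> \<bar>\<phi> s\<bar> \<le> c * s powr (a - 1)" "continuous_on {0<..} \<phi>"
  shows "norm (integral {0<..} (\<lambda>s. \<phi> s *\<^sub>R T s x)) \<le> c * K * norm x * (Gamma a / w powr a)"
proof -
  have int: "(\<lambda>s. \<phi> s *\<^sub>R T s x) integrable_on {0<..}"
    using weighted_antiderivative[of a \<phi> c x, OF assms] by metis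
  show ?thesis
    using Henstock_Kurzweil_Integration.integral_norm_bound_integral[OF int
        has_integral_integrable[OF weight_dominated(1)[OF assms(1,2)]] weight_dominated(2)[OF assms(1,2)]]
      integral_unique[OF weight_dominated(1)[OF assms(1,2)]] by simp
qed

lemma powr_weight:
  assumes "a > 0"
  shows "s > 0 \<Longrightarrow> \<bar>s powr (a - 1)\<bar> \<le> 1 * s powr (a - 1)" "continuous_on {0<..} (\<lambda>s::real. s powr (a - 1))"
  by (auto intro!: continuous_intros)

section \<open>Negative fractional powers as weighted integrals of the semigroup\<close>

abbreviation W :: "real \<Rightarrow> ('a \<Rightarrow>\<^sub>L 'a)" where "W a \<equiv> neg_frac_pow T a"

abbreviation R :: "'a \<Rightarrow>\<^sub>L 'a" where "R \<equiv> W 1"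

lemma powr_integrable: "a > 0 \<Longrightarrow> (\<lambda>s. s powr (a - 1) *\<^sub>R T s x) integrable_on {0<..}"
  using weighted_antiderivative[of a "\<lambda>s. s powr (a - 1)" 1 x] powr_weight by metis

lemma W_apply:
  assumes "a > 0"
  shows "W a x = (1 / Gamma a) *\<^sub>R integral {0<..} (\<lambda>s. s powr (a - 1) *\<^sub>R T s x)"
    and norm_W_apply: "norm (W a x) \<le> K / w powr a * norm x"
proof -
  let ?h = "\<lambda>x. (1 / Gamma a) *\<^sub>R integral {0<..} (\<lambda>s. s powr (a - 1) *\<^sub>R T s x)"
  have G: "Gamma a > 0" using assms by (rule Gamma_real_pos)
  have bd: "norm (?h x) \<le> norm x * (K / w powr a)" for x
    using divide_right_mono[OF norm_weighted_integral[OF assms powr_weight[OF assms], of x], of "Gamma a"] G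
    by (simp add: mult_ac)
  have "bounded_linear ?h"
  proof (rule bounded_linear_intro)
    show "?h (x + y) = ?h x + ?h y" for x y
      by (simp add: blinfun.add_right scaleR_add_right integral_add powr_integrable[OF assms])
    show "?h (r *\<^sub>R x) = r *\<^sub>R ?h x" for r x
    proof -
      have "(\<lambda>s. s powr (a - 1) *\<^sub>R T s (r *\<^sub>R x)) = (\<lambda>s. r *\<^sub>R (s powr (a - 1) *\<^sub>R T s x))"
        by (simp add: blinfun.scaleR_right mult.commute)
      then show ?thesis by (simp only: integral_cmul scaleR_left_commute[of _ r])
    qed
    show "norm (?h x) \<le> norm x * (K / w powr a)" for x by (rule bd)
  qed
  then show eq: "W a x = ?h x"
    by (simp add: neg_frac_pow_def bounded_linear_Blinfun_apply)
  show "norm (W a x) \<le> K / w powr a * norm x"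
    unfolding eq using bd by (simp add: mult.commute)
qed

lemma norm_W: "a > 0 \<Longrightarrow> norm (W a) \<le> K / w powr a"
  by (rule norm_blinfun_bound[OF _ norm_W_apply]) (use K_pos in auto)

lemma W_has_integral:
  assumes "a > 0"
  shows "((\<lambda>s. s powr (a - 1) *\<^sub>R T s x) has_integral Gamma a *\<^sub>R W a x) {0<..}"
proof -
  have "Gamma a *\<^sub>R W a x = integral {0<..} (\<lambda>s. s powr (a - 1) *\<^sub>R T s x)"
    using Gamma_real_pos[OF assms] by (simp add: W_apply(1)[OF assms])
  then show ?thesis using integrable_integral[OF powr_integrable[OF assms]] by simp
qed

text \<open>Bounded operators pass through the integral. Commutation of powers, also those of
  different shifts, is thereby reduced to commutation with the semigroup.\<close>

lemma W_commute:
  assumes "a > 0" "\<And>s. s > 0 \<Longrightarrow> C o\<^sub>L T s = T s o\<^sub>L C"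
  shows "C o\<^sub>L W a = W a o\<^sub>L C"
proof (rule blinfun_eqI)
  fix x
  have eq: "C (T s x) = T s (C x)" if "s > 0" for s
    using arg_cong[OF assms(2)[OF that], of "\<lambda>D. blinfun_apply D x"] by simp
  have "C (integral {0<..} (\<lambda>s. s powr (a - 1) *\<^sub>R T s x)) =
      integral {0<..} (blinfun_apply C \<circ> (\<lambda>s. s powr (a - 1) *\<^sub>R T s x))"
    by (rule integral_linear[symmetric, OF powr_integrable[OF assms(1)] blinfun.bounded_linear_right])
  also have "\<dots> = integral {0<..} (\<lambda>s. s powr (a - 1) *\<^sub>R T s (C x))"
    by (rule integral_cong) (simp add: blinfun.scaleR_right eq)
  finally show "(C o\<^sub>L W a) x = (W a o\<^sub>L C) x"
    by (simp add: W_apply[OF assms(1)] blinfun.scaleR_right)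
qed

lemma T_W_commute: "a > 0 \<Longrightarrow> s \<ge> 0 \<Longrightarrow> T s o\<^sub>L W a = W a o\<^sub>L T s"
  by (rule W_commute) (auto intro: T_commute)

lemma W_W_commute: "a > 0 \<Longrightarrow> b > 0 \<Longrightarrow> W a o\<^sub>L W b = W b o\<^sub>L W a"
  by (rule W_commute) (auto intro: T_W_commute[symmetric])

text \<open>Since \<open>R x\<close> is the integral of the whole orbit, applying \<open>T s\<close>
  removes the piece over {0..s}. The derivative is then the integrand at s with a minus
  sign.\<close>

lemma T_R_has_vector_derivative:
  assumes "s \<ge> 0"
  shows "((\<lambda>s. T s (R x)) has_vector_derivative - T s x) (at s within {0..})"
proof -
  obtain F where F0: "continuous_on {0..} F" "F 0 = 0"
    "\<And>s. s > 0 \<Longrightarrow> (F has_vector_derivative 1 *\<^sub>R T s x) (at s)"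
    "(F \<longlongrightarrow> integral {0<..} (\<lambda>s. 1 *\<^sub>R T s x)) at_top"
    by (rule weighted_antiderivative[of 1 "\<lambda>_. 1" 1 x]) (simp_all add: continuous_on_const)
  then have F: "continuous_on {0..} F" "F 0 = 0"
    "\<And>s. s > 0 \<Longrightarrow> (F has_vector_derivative T s x) (at s)"
    "(F \<longlongrightarrow> integral {0<..} (\<lambda>s. T s x)) at_top" by (simp_all only: scaleR_one)
  have R: "R x = integral {0<..} (\<lambda>s. T s x)"
  proof -
    have "integral {0<..} (\<lambda>s. s powr (1 - 1) *\<^sub>R T s x) = integral {0<..} (\<lambda>s. T s x)"
      by (rule integral_cong) simp
    then show ?thesis using W_apply(1)[of 1 x] by simp
  qed
  have shift: "T s (R x) = R x - F s" if "s \<ge> 0" for s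
  proof -
    \<comment> \<open>Translation of the integral: both sides vanish at N = 0 and have the
      derivative T (s + N) x in N.\<close>
    have sh: "T s (F N) = F (N + s) - F s" if "N > 0" for N
    proof -
      let ?D = "\<lambda>N. T s (F N) - F (N + s)"
      have "norm (?D N - ?D 0) \<le> (\<lambda>_. 0) N - (\<lambda>_. 0) 0"
      proof (rule differentiable_bound_general[OF that, where f' = "\<lambda>_. 0" and \<phi>' = "\<lambda>_. 0"])
        show "continuous_on {0..N} ?D"
          by (intro continuous_intros continuous_on_compose2[OF F(1)] continuous_on_subset[OF F(1)])
            (use \<open>s \<ge> 0\<close> in auto)
        fix r :: real assume "0 < r"
        have "((\<lambda>r. F (r + s)) has_vector_derivative T (r + s) x) (at r)"
        proof -
          have "((\<lambda>r. r + s) has_vector_derivative 1) (at r)"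
            by (simp add: has_vector_derivative_add_const)
          from vector_diff_chain_at[OF this F(3)] show ?thesis
            using \<open>0 < r\<close> \<open>s \<ge> 0\<close> by (simp add: o_def)
        qed
        from has_vector_derivative_diff[OF bounded_linear.has_vector_derivative[OF blinfun.bounded_linear_right[of "T s"] F(3)[OF \<open>0 < r\<close>]] this]
        show "(?D has_vector_derivative 0) (at r)"
          using T_add[of s r] \<open>0 < r\<close> \<open>s \<ge> 0\<close> by (simp add: add.commute)
      qed auto
      then show ?thesis using F(2) by (simp add: blinfun.zero_right algebra_simps)
    qed
    have ev: "\<forall>\<^sub>F N in at_top. F (N + s) - F s = T s (F N)"
      using eventually_gt_at_top[of 0] by eventually_elim (simp add: sh)
    have "((\<lambda>N. F (N + s) - F s) \<longlongrightarrow> R x - F s) at_top"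
      by (intro tendsto_intros filterlim_compose[OF F(4)[folded R]])
        (auto intro!: filterlim_at_top_mono[OF filterlim_ident] simp: \<open>s \<ge> 0\<close>)
    then have "((\<lambda>N. T s (F N)) \<longlongrightarrow> R x - F s) at_top"
      by (rule Lim_transform_eventually[OF _ ev])
    moreover have "((\<lambda>N. T s (F N)) \<longlongrightarrow> T s (R x)) at_top"
      by (intro tendsto_intros F(4)[folded R])
    ultimately show ?thesis using tendsto_unique[OF trivial_limit_at_top_linorder] by blast
  qed
  \<comment> \<open>F is known to be differentiable at positive times only; the indefinite integral
    of a continuous orbit also has the one-sided derivative at 0.\<close>
  have F_int: "F s = integral {0..s} (\<lambda>s. T s x)" if "s \<ge> 0" for s
    using fundamental_theorem_of_calculus_interior[OF that continuous_on_subset[OF F(1)] F(3)] F(2)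
    by (auto simp: integral_unique)
  have int: "((\<lambda>s. integral {0..s} (\<lambda>s. T s x)) has_vector_derivative T s x) (at s within {0..s+1})"
    by (rule integral_has_vector_derivative[OF continuous_on_subset[OF T_continuous]]) (use assms in auto)
  then have "((\<lambda>s. integral {0..s} (\<lambda>s. T s x)) has_vector_derivative T s x) (at s within {0..})"
  proof -
    have "at s within {0..s+1} = at s within {0..}"
      by (rule at_within_nhd[of s "{..<s+1}"]) auto
    with int show ?thesis by simp
  qed
  then have "((\<lambda>s. R x - integral {0..s} (\<lambda>s. T s x)) has_vector_derivative - T s x) (at s within {0..})"
    by (auto intro!: derivative_eq_intros)
  then show ?thesis
    by (rule has_vector_derivative_transform[rotated 2]) (use assms shift F_int in auto)
qed

text \<open>The derivative of \<open>T s (R x)\<close> is bounded by K * norm x uniformly in s, so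
  one factor \<open>R\<close> turns strong continuity into a Lipschitz bound in operator
  norm.\<close>

lemma R_continuous: "continuous_on {0..} (\<lambda>s. T s o\<^sub>L R)"
  and norm_T_R_diff: "s \<ge> 0 \<Longrightarrow> r \<ge> 0 \<Longrightarrow> norm (T s (R x) - T r (R x)) \<le> K * \<bar>s - r\<bar> * norm x"
proof -
  have le: "norm (T s (R x) - T r (R x)) \<le> K * \<bar>s - r\<bar> * norm x" if "s \<ge> 0" "r \<ge> 0" for s r x
    using norm_diff_le_vector_derivative[of "{0..}" "\<lambda>s. T s (R x)" "\<lambda>s. - T s x" "K * norm x" s r]
      T_R_has_vector_derivative norm_T that by (simp add: mult_ac)
  have "norm ((T s o\<^sub>L R) - (T r o\<^sub>L R)) \<le> K * \<bar>s - r\<bar>" if "s \<ge> 0" "r \<ge> 0" for s r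
    by (rule norm_blinfun_bound) (use le that K_pos in \<open>auto simp: blinfun.diff_left\<close>)
  then have "K-lipschitz_on {0..} (\<lambda>s. T s o\<^sub>L R)"
    by (intro lipschitz_onI) (use K_pos in \<open>auto simp: dist_norm\<close>)
  then show "continuous_on {0..} (\<lambda>s. T s o\<^sub>L R)" by (rule lipschitz_on_continuous_on)
  show "norm (T s (R x) - T r (R x)) \<le> K * \<bar>s - r\<bar> * norm x" if "s \<ge> 0" "r \<ge> 0" by (rule le[OF that])
qed

text \<open>The derivative of the strong remainder is \<open>T s (R x) - T q (R x)\<close>, of size
  K |s - q| norm x. Integrating once more gives a remainder quadratic in r - s, uniformly over unit
  vectors.\<close>

lemma T_R_R_has_vector_derivative:
  assumes "s \<ge> 0"
  shows "((\<lambda>s. T s o\<^sub>L (R o\<^sub>L R)) has_vector_derivative - (T s o\<^sub>L R)) (at s within {0..})"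
proof (rule has_vector_derivative_quadratic)
  fix r :: real assume "r \<in> {0..}"
  then have r: "r \<ge> 0" by simp
  show "norm ((T r o\<^sub>L (R o\<^sub>L R)) - (T s o\<^sub>L (R o\<^sub>L R)) - (r - s) *\<^sub>R (- (T s o\<^sub>L R))) \<le> K * (r - s)\<^sup>2"
  proof (rule norm_blinfun_bound)
    fix x
    let ?S = "{min r s..max r s}"
    let ?g = "\<lambda>q. T q (R (R x)) + q *\<^sub>R T s (R x)"
    have "norm (?g r - ?g s) \<le> (K * \<bar>r - s\<bar> * norm x) * \<bar>r - s\<bar>"
    proof (rule norm_diff_le_vector_derivative[where f' = "\<lambda>q. T s (R x) - T q (R x)"])
      fix q assume q: "q \<in> ?S"
      then have "q \<ge> 0" using r assms by auto
      then have "((\<lambda>q. T q (R (R x))) has_vector_derivative - T q (R x)) (at q within ?S)"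
        by (rule has_vector_derivative_within_subset[OF T_R_has_vector_derivative]) (use r assms in auto)
      then show "(?g has_vector_derivative T s (R x) - T q (R x)) (at q within ?S)"
        by (auto intro!: derivative_eq_intros)
      have "norm (T s (R x) - T q (R x)) \<le> K * \<bar>s - q\<bar> * norm x"
        using norm_T_R_diff \<open>q \<ge> 0\<close> assms by blast
      also have "\<dots> \<le> K * \<bar>r - s\<bar> * norm x"
        by (intro mult_left_mono mult_right_mono) (use q K_pos in auto)
      finally show "norm (T s (R x) - T q (R x)) \<le> K * \<bar>r - s\<bar> * norm x" .
    qed auto
    moreover have "((T r o\<^sub>L (R o\<^sub>L R)) - (T s o\<^sub>L (R o\<^sub>L R)) - (r - s) *\<^sub>R (- (T s o\<^sub>L R))) x = ?g r - ?g s"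
      by (simp add: blinfun.diff_left blinfun.add_left blinfun.scaleR_left blinfun.minus_left scaleR_diff_left)
    moreover have "(K * \<bar>r - s\<bar> * norm x) * \<bar>r - s\<bar> = K * (\<bar>r - s\<bar> * \<bar>r - s\<bar>) * norm x" by (simp only: mult_ac)
    ultimately show "norm (((T r o\<^sub>L (R o\<^sub>L R)) - (T s o\<^sub>L (R o\<^sub>L R)) - (r - s) *\<^sub>R (- (T s o\<^sub>L R))) x)
        \<le> K * (r - s)\<^sup>2 * norm x"
      by (simp add: power2_eq_square)
  qed (use K_pos in auto)
qed

section \<open>Identifying the inverse of the generator\<close>

lemma difference_quotient_R: "((\<lambda>h. (1 / h) *\<^sub>R (R x - T h (R x))) \<longlongrightarrow> x) (at_right 0)"
proof -
  have "((\<lambda>h. (1 / h) *\<^sub>R (T h (R x) - R x)) \<longlongrightarrow> - x) (at_right 0)"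
  proof -
    have "((\<lambda>h. (1 / norm (h - 0)) *\<^sub>R (T h (R x) - (T 0 (R x) + (h - 0) *\<^sub>R (- T 0 x)))) \<longlongrightarrow> 0) (at_right 0)"
      using T_R_has_vector_derivative[of 0 x]
      unfolding has_vector_derivative_def has_derivative_within at_within_Ici_at_right by simp
    from tendsto_add[OF this tendsto_const[of "- x"]]
    have "((\<lambda>h. (1 / norm (h - 0)) *\<^sub>R (T h (R x) - (T 0 (R x) + (h - 0) *\<^sub>R (- T 0 x))) + - x) \<longlongrightarrow> - x) (at_right 0)"
      by simp
    then show ?thesis
      by (rule Lim_transform_eventually)
        (auto simp: eventually_at_filter scaleR_diff_right scaleR_add_right algebra_simps)
  qed
  from tendsto_minus[OF this] show ?thesis by (simp flip: scaleR_minus_right)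
qed

lemma norm_difference_quotient_R:
  assumes "h > 0"
  shows "norm ((1 / h) *\<^sub>R (R x - T h (R x))) \<le> K * norm x"
  using norm_T_R_diff[of 0 h x] assms unfolding norm_scaleR by (simp add: field_simps)

lemma gen_inv_eq: "gen_inv T = - R"
proof -
  have gen: "((\<lambda>h. (1 / h) *\<^sub>R (T h ((- R) x) - (- R) x)) \<longlongrightarrow> x) (at_right 0)" for x
    using difference_quotient_R[of x] by (simp add: blinfun.minus_left blinfun.minus_right)
  have 1: "(- R) x \<in> gen_dom T" "generator T ((- R) x) = x" for x
    using gen[of x] by (auto simp: gen_dom_def generator_def intro: tendsto_Lim)
  \<comment> \<open>Left inverse: \<open>R\<close> commutes with \<open>T h\<close>, so it maps the
    difference quotient of x to that of \<open>R x\<close>, whose limit is already known.\<close>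
  have 2: "(- R) (generator T x) = x" if x: "x \<in> gen_dom T" for x
  proof -
    obtain y where y: "((\<lambda>h. (1 / h) *\<^sub>R (T h x - x)) \<longlongrightarrow> y) (at_right 0)"
      using x by (auto simp: gen_dom_def)
    then have gy: "generator T x = y" by (auto simp: generator_def intro: tendsto_Lim)
    have "((\<lambda>h. R ((1 / h) *\<^sub>R (T h x - x))) \<longlongrightarrow> R y) (at_right 0)"
      by (intro tendsto_intros y)
    moreover have "((\<lambda>h. R ((1 / h) *\<^sub>R (T h x - x))) \<longlongrightarrow> - x) (at_right 0)"
    proof (rule Lim_transform_eventually)
      show "((\<lambda>h. - ((1 / h) *\<^sub>R (R x - T h (R x)))) \<longlongrightarrow> - x) (at_right 0)"
        by (intro tendsto_minus difference_quotient_R)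
      show "\<forall>\<^sub>F h in at_right 0. - ((1 / h) *\<^sub>R (R x - T h (R x))) = R ((1 / h) *\<^sub>R (T h x - x))"
        unfolding eventually_at_filter
      proof (intro always_eventually allI impI)
        fix h :: real assume "h \<in> {0<..}"
        then have "R (T h x) = T h (R x)"
          using arg_cong[OF T_W_commute[of 1 h], of "\<lambda>D. blinfun_apply D x"] by simp
        then show "- ((1 / h) *\<^sub>R (R x - T h (R x))) = R ((1 / h) *\<^sub>R (T h x - x))"
          by (simp add: blinfun.scaleR_right blinfun.diff_right flip: scaleR_minus_right)
      qed
    qed
    ultimately have "R y = - x" using tendsto_unique[OF trivial_limit_at_right_real] by blast
    then show ?thesis by (simp add: gy blinfun.minus_left)
  qed
  show ?thesis
    unfolding gen_inv_def
  proof (rule the_equality)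
    show "(\<forall>x. (- R) x \<in> gen_dom T \<and> generator T ((- R) x) = x) \<and> (\<forall>x\<in>gen_dom T. (- R) (generator T x) = x)"
      using 1 2 by blast
    fix B :: "'a \<Rightarrow>\<^sub>L 'a"
    assume "(\<forall>x. B x \<in> gen_dom T \<and> generator T (B x) = x) \<and> (\<forall>x\<in>gen_dom T. B (generator T x) = x)"
    then show "B = - R" by (intro blinfun_eqI) (metis 2)
  qed
qed

text \<open>Integration by parts: s^a T s (R x) vanishes at 0 and at infinity, so its derivative has
  integral 0. The functional equation of Gamma adjusts the normalisations.\<close>

lemma W_Suc:
  assumes "a > 0"
  shows "W (a + 1) = R o\<^sub>L W a"
proof -
  have "W (a + 1) x = W a (R x)" for x
  proof -
    let ?\<Phi> = "\<lambda>s. s powr a *\<^sub>R T s (R x)"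
    let ?f = "\<lambda>s. a *\<^sub>R (s powr (a - 1) *\<^sub>R T s (R x)) - s powr (a + 1 - 1) *\<^sub>R T s x"
    have i1: "(?f has_integral (0 - ?\<Phi> 0)) {0<..}"
    proof (rule has_integral_improper_FTC)
      show "continuous_on {0..} ?\<Phi>"
        by (intro continuous_intros continuous_on_powr' T_continuous) (use assms in auto)
      show "(?\<Phi> \<longlongrightarrow> 0) at_top"
      proof (rule Lim_null_comparison)
        show "((\<lambda>s. (K * norm (R x)) * (s powr a * exp (- (w * s)))) \<longlongrightarrow> 0) at_top"
          by (rule tendsto_mult_right_zero[OF powr_exp_tendsto_0[OF w_pos]])
        show "\<forall>\<^sub>F s in at_top. norm (?\<Phi> s) \<le> (K * norm (R x)) * (s powr a * exp (- (w * s)))"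
          using eventually_ge_at_top[of 0]
        proof eventually_elim
          case (elim s)
          have "norm (?\<Phi> s) = s powr a * norm (T s (R x))" by simp
          also have "\<dots> \<le> s powr a * (K * exp (- (w * s)) * norm (R x))"
            by (intro mult_left_mono norm_T_apply elim) auto
          finally show ?case by (simp add: mult_ac)
        qed
      qed
      fix s :: real assume s: "s > 0"
      have "((\<lambda>s. T s (R x)) has_vector_derivative - T s x) (at s within {0..})"
        using T_R_has_vector_derivative s by simp
      moreover have "at s within {0..} = at s" using s by (intro at_within_interior) auto
      ultimately have T: "((\<lambda>s. T s (R x)) has_vector_derivative - T s x) (at s)" by simp
      have p: "((\<lambda>s. s powr a) has_real_derivative a * s powr (a - 1)) (at s)"
        by (rule has_real_derivative_powr[OF s])
      from has_vector_derivative_scaleR[OF p T]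
      show "(?\<Phi> has_vector_derivative ?f s) (at s)" by simp
    qed
    have i2: "(?f has_integral (a *\<^sub>R (Gamma a *\<^sub>R W a (R x)) - Gamma (a + 1) *\<^sub>R W (a + 1) x)) {0<..}"
    proof (intro has_integral_diff has_integral_cmul)
      show "((\<lambda>s. s powr (a - 1) *\<^sub>R T s (R x)) has_integral Gamma a *\<^sub>R W a (R x)) {0<..}"
        by (rule W_has_integral[OF assms])
      show "((\<lambda>s. s powr (a + 1 - 1) *\<^sub>R T s x) has_integral Gamma (a + 1) *\<^sub>R W (a + 1) x) {0<..}"
        using assms by (intro W_has_integral) simp
    qed
    have "a *\<^sub>R (Gamma a *\<^sub>R W a (R x)) - Gamma (a + 1) *\<^sub>R W (a + 1) x = 0"
      using has_integral_unique[OF i2 i1] assms by simp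
    moreover have "Gamma (a + 1) = a * Gamma a" using assms by (intro Gamma_plus1) auto
    ultimately show ?thesis using assms Gamma_real_pos[OF assms] by simp
  qed
  then show ?thesis
    using W_W_commute[OF assms, of 1] by (intro blinfun_eqI) (metis blinfun_apply_blinfun_compose zero_less_one)
qed

text \<open>The defining integral is cut at d. The part near 0 uses the plain bound on
  \<open>T\<close>; on the tail, integration by parts exchanges x for \<open>R x\<close>. The factor
  2 collects the boundary term at d and the tail integral, which telescopes because a \<le> 1 makes
  s^(a-1) nonincreasing. The cut d stays free, to be optimised later.\<close>

lemma moment_inequality:
  assumes a: "0 < a" "a \<le> 1" and d: "d > 0"
  shows "Gamma a * norm (W a x) \<le> K * d powr a / a * norm x + 2 * K * d powr (a - 1) * norm (R x)"
proof -
  have *: "integral {0<..} (\<lambda>s. s powr (a - 1) *\<^sub>R T s x) = Gamma a *\<^sub>R W a x"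
    by (rule integral_unique[OF W_has_integral[OF a(1)]])
  from weighted_antiderivative[of a "\<lambda>s. s powr (a - 1)" 1 x, OF a(1) powr_weight[OF a(1)]]
  obtain F where F: "continuous_on {0..} F" "F 0 = 0"
    "\<And>s. s > 0 \<Longrightarrow> (F has_vector_derivative s powr (a - 1) *\<^sub>R T s x) (at s)"
    "(F \<longlongrightarrow> Gamma a *\<^sub>R W a x) at_top" unfolding * by blast
  have "norm (F d - F 0) \<le> (\<lambda>s. K * norm x * (s powr a / a)) d - (\<lambda>s. K * norm x * (s powr a / a)) 0"
  proof (rule differentiable_bound_general[OF d continuous_on_subset[OF F(1)]])
    show "continuous_on {0..d} (\<lambda>s. K * norm x * (s powr a / a))"
      by (intro continuous_intros continuous_on_powr') (use a in auto)
    fix s :: real assume s: "0 < s"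
    show "(F has_vector_derivative s powr (a - 1) *\<^sub>R T s x) (at s)" by (rule F(3)[OF s])
    have "((\<lambda>s. K * norm x * (s powr a / a)) has_real_derivative K * norm x * (a * s powr (a - 1) / a)) (at s)"
      by (intro DERIV_cmult DERIV_cdivide has_real_derivative_powr s)
    then show "((\<lambda>s. K * norm x * (s powr a / a)) has_vector_derivative K * norm x * s powr (a - 1)) (at s)"
      using a by (simp add: has_real_derivative_iff_has_vector_derivative)
    show "norm (s powr (a - 1) *\<^sub>R T s x) \<le> K * norm x * s powr (a - 1)"
      using mult_left_mono[OF norm_T[of s x], of "s powr (a - 1)"] s by (simp add: mult_ac)
  qed auto
  then have 1: "norm (F d) \<le> K * d powr a / a * norm x" using F(2) a by (simp add: mult_ac)
  \<comment> \<open>The added boundary term cancels T s x in the derivative, which then contains T s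
    (R x) alone.\<close>
  let ?H = "\<lambda>s. F s + s powr (a - 1) *\<^sub>R T s (R x)"
  have 2: "norm (?H N - ?H d) \<le> d powr (a - 1) * (K * norm (R x))" if "N > d" for N
  proof -
    have "norm (?H N - ?H d) \<le> (\<lambda>s. - (s powr (a - 1) * (K * norm (R x)))) N - (\<lambda>s. - (s powr (a - 1) * (K * norm (R x)))) d"
    proof (rule differentiable_bound_general[OF that])
      show "continuous_on {d..N} ?H"
        by (intro continuous_intros continuous_on_subset[OF F(1)] continuous_on_subset[OF T_continuous]) (use d in auto)
      show "continuous_on {d..N} (\<lambda>s. - (s powr (a - 1) * (K * norm (R x))))"
        by (intro continuous_intros) (use d in auto)
      fix s assume "d < s"
      then have s: "s > 0" using d by simp
      have "((\<lambda>s. T s (R x)) has_vector_derivative - T s x) (at s within {0..})"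
        using T_R_has_vector_derivative s by simp
      moreover have "at s within {0..} = at s" using s by (intro at_within_interior) auto
      ultimately have T: "((\<lambda>s. T s (R x)) has_vector_derivative - T s x) (at s)" by simp
      have p: "((\<lambda>s. s powr (a - 1)) has_real_derivative (a - 1) * s powr (a - 1 - 1)) (at s)"
        by (rule has_real_derivative_powr[OF s])
      from has_vector_derivative_add[OF F(3)[OF s] has_vector_derivative_scaleR[OF p T]]
      show "(?H has_vector_derivative ((a - 1) * s powr (a - 1 - 1)) *\<^sub>R T s (R x)) (at s)" by simp
      have "((\<lambda>s. - (s powr (a - 1) * (K * norm (R x)))) has_real_derivative
          - ((a - 1) * s powr (a - 1 - 1) * (K * norm (R x)))) (at s)"
        by (intro DERIV_minus DERIV_cmult_right p)
      then show "((\<lambda>s. - (s powr (a - 1) * (K * norm (R x)))) has_vector_derivative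
          (1 - a) * s powr (a - 1 - 1) * (K * norm (R x))) (at s)"
        by (simp add: has_real_derivative_iff_has_vector_derivative algebra_simps)
      have "norm (((a - 1) * s powr (a - 1 - 1)) *\<^sub>R T s (R x)) = (1 - a) * s powr (a - 1 - 1) * norm (T s (R x))"
        using a by (simp add: abs_mult)
      also have "\<dots> \<le> (1 - a) * s powr (a - 1 - 1) * (K * norm (R x))"
        by (intro mult_left_mono norm_T) (use a s in auto)
      finally show "norm (((a - 1) * s powr (a - 1 - 1)) *\<^sub>R T s (R x)) \<le> (1 - a) * s powr (a - 1 - 1) * (K * norm (R x))" .
    qed
    then show ?thesis using K_pos by (simp add: order_trans[OF _ diff_left_mono[of 0]] add.commute) (smt (verit) mult_nonneg_nonneg norm_ge_zero powr_ge_zero)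
  qed
  have H_lim: "(?H \<longlongrightarrow> Gamma a *\<^sub>R W a x) at_top"
  proof -
    have "((\<lambda>s. s powr (a - 1) *\<^sub>R T s (R x)) \<longlongrightarrow> 0) at_top"
    proof (rule Lim_null_comparison)
      show "((\<lambda>s. (K * norm (R x)) * (s powr (a - 1) * exp (- (w * s)))) \<longlongrightarrow> 0) at_top"
        by (rule tendsto_mult_right_zero[OF powr_exp_tendsto_0[OF w_pos]])
      show "\<forall>\<^sub>F s in at_top. norm (s powr (a - 1) *\<^sub>R T s (R x)) \<le> (K * norm (R x)) * (s powr (a - 1) * exp (- (w * s)))"
        using eventually_ge_at_top[of 0]
      proof eventually_elim
        case (elim s)
        have "norm (s powr (a - 1) *\<^sub>R T s (R x)) = s powr (a - 1) * norm (T s (R x))" by simp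
        also have "\<dots> \<le> s powr (a - 1) * (K * exp (- (w * s)) * norm (R x))"
          by (intro mult_left_mono norm_T_apply elim) auto
        finally show ?case by (simp add: mult_ac)
      qed
    qed
    from tendsto_add[OF F(4) this] show ?thesis by simp
  qed
  have "norm (Gamma a *\<^sub>R W a x - ?H d) \<le> d powr (a - 1) * (K * norm (R x))"
  proof (rule tendsto_upperbound[OF tendsto_norm[OF tendsto_diff[OF H_lim tendsto_const]]])
    show "\<forall>\<^sub>F N in at_top. norm (?H N - ?H d) \<le> d powr (a - 1) * (K * norm (R x))"
      using eventually_gt_at_top[of d] by eventually_elim (rule 2)
  qed simp
  moreover have "norm (d powr (a - 1) *\<^sub>R T d (R x)) \<le> d powr (a - 1) * (K * norm (R x))"
    using mult_left_mono[OF norm_T[of d "R x"], of "d powr (a - 1)"] d by simp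
  ultimately have "norm (Gamma a *\<^sub>R W a x) \<le> K * d powr a / a * norm x + 2 * (d powr (a - 1) * (K * norm (R x)))"
    using 1 norm_triangle_ineq[of "Gamma a *\<^sub>R W a x - ?H d" "?H d"]
      norm_triangle_ineq[of "F d" "d powr (a - 1) *\<^sub>R T d (R x)"] by simp
  then show ?thesis using Gamma_real_pos[OF a(1)] by (simp add: mult_ac)
qed

text \<open>A Landau-Kolmogorov inequality with \<open>R\<close> between the identity and the square
  of \<open>R\<close>: first-order Taylor expansion of \<open>T s (R (R x))\<close> over a step h
  expresses h \<open>R x\<close> by an increment of the orbit and a remainder of size K h^2 norm
  x.\<close>

lemma landau_inequality:
  assumes h: "h > 0"
  shows "norm (R x) \<le> K * h * norm x + (K + 1) / h * norm (R (R x))"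
proof -
  let ?g = "\<lambda>s. T s (R (R x)) + s *\<^sub>R R x"
  have "norm (?g h - ?g 0) \<le> (K * h * norm x) * \<bar>h - 0\<bar>"
  proof (rule norm_diff_le_vector_derivative[where f' = "\<lambda>s. R x - T s (R x)" and S = "{0..h}"])
    fix s assume s: "s \<in> {0..h}"
    have "((\<lambda>s. T s (R (R x))) has_vector_derivative - T s (R x)) (at s within {0..h})"
      by (rule has_vector_derivative_within_subset[OF T_R_has_vector_derivative]) (use s in auto)
    then show "(?g has_vector_derivative R x - T s (R x)) (at s within {0..h})"
      by (auto intro!: derivative_eq_intros)
    have "norm (R x - T s (R x)) \<le> K * s * norm x" using norm_T_R_diff[of 0 s x] s by simp
    also have "\<dots> \<le> K * h * norm x" by (intro mult_left_mono mult_right_mono) (use s K_pos in auto)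
    finally show "norm (R x - T s (R x)) \<le> K * h * norm x" .
  qed (use h in auto)
  then have 1: "norm (?g h - R (R x)) \<le> K * h * norm x * h" using h by simp
  have "h *\<^sub>R R x = (?g h - R (R x)) + (R (R x) - T h (R (R x)))" by simp
  then have "norm (h *\<^sub>R R x) \<le> norm (?g h - R (R x)) + norm (R (R x) - T h (R (R x)))"
    by (metis norm_triangle_ineq)
  also have "norm (R (R x) - T h (R (R x))) \<le> norm (R (R x)) + K * norm (R (R x))"
    using norm_triangle_ineq4[of "R (R x)" "T h (R (R x))"] norm_T[of h "R (R x)"] h by simp
  finally have "h * norm (R x) \<le> K * h * norm x * h + (K + 1) * norm (R (R x))"
    using 1 h by (simp add: algebra_simps)
  then show ?thesis using h by (simp add: field_simps)
qed

end

section \<open>The energy estimate\<close>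

lemma integral_reflect_interval:
  fixes f :: "real \<Rightarrow> real"
  shows "integral {0..t} (\<lambda>x. f (t - x)) = integral {0..t} f"
  using integral_shift_Icc_real[of 0 t "\<lambda>x. f (- x)" "- t"] Henstock_Kurzweil_Integration.integral_reflect_real[of t 0 f]
  by (simp add: o_def)

text \<open>
  Both \<open>s \<mapsto> U s\<close> and \<open>\<tau> \<mapsto> V \<tau>\<close> are differentiated against \<open>R\<close>, so that
  \<open>\<partial>\<^sub>\<tau> (norm (U s (V \<tau> v)))\<^sup>2 = \<partial>\<^sub>s (norm (U s (R (V \<tau> v))))\<^sup>2\<close>; integrate over a rectangle.
\<close>
lemma energy_estimate:
  fixes R :: "'a::{real_inner, banach} \<Rightarrow>\<^sub>L 'a"
  assumes U': "\<And>s. s \<ge> 0 \<Longrightarrow> ((\<lambda>s. U s o\<^sub>L R) has_vector_derivative - U s) (at s within {0..})"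
    and U_cont: "continuous_on {0..} U" and U_0: "U 0 = R"
    and U_le: "\<And>s v. s \<ge> 0 \<Longrightarrow> norm (U s v) \<le> K * exp (- (w * s)) * norm (R v)"
    and V': "\<And>t. (V has_vector_derivative - (R o\<^sub>L V t)) (at t)" and V_0: "V 0 = id_blinfun"
    and w: "w > 0" and t: "t \<ge> 0"
  shows "integral {0..t} (\<lambda>\<tau>. (norm (R (R (V \<tau> v))))\<^sup>2) \<le> K\<^sup>2 / (2 * w) * (norm (R v))\<^sup>2"
proof -
  have V_cont: "continuous_on A V" for A
    using has_vector_derivative_continuous[OF V'] continuous_at_imp_continuous_on by blast
  have Vv_cont: "continuous_on A (\<lambda>\<tau>. V \<tau> v)" for A
    by (intro continuous_intros V_cont)
  let ?g = "\<lambda>s \<tau>. - 2 * (U s (V \<tau> v) \<bullet> U s (R (V \<tau> v)))"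
  let ?I = "integral {0..t} (\<lambda>\<tau>. (norm (R (R (V \<tau> v))))\<^sup>2)"
  have ds: "((\<lambda>s. ?g s \<tau>) has_integral (norm (U N (R (V \<tau> v))))\<^sup>2 - (norm (R (R (V \<tau> v))))\<^sup>2) {0..N}"
    if "N \<ge> 0" for \<tau> N
  proof -
    have "((\<lambda>s. ?g s \<tau>) has_integral (norm (U N (R (V \<tau> v))))\<^sup>2 - (norm (U 0 (R (V \<tau> v))))\<^sup>2) {0..N}"
    proof (rule fundamental_theorem_of_calculus[OF that])
      fix s assume "s \<in> {0..N}"
      then have "((\<lambda>s. U s o\<^sub>L R) has_vector_derivative - U s) (at s within {0..N})"
        by (intro has_vector_derivative_within_subset[OF U']) auto
      from bounded_linear.has_vector_derivative[OF blinfun.bounded_linear_left this, of "V \<tau> v"]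
      have "((\<lambda>s. U s (R (V \<tau> v))) has_vector_derivative - U s (V \<tau> v)) (at s within {0..N})"
        by (simp add: blinfun.minus_left)
      from bounded_bilinear.has_vector_derivative[OF bounded_bilinear_inner this this]
      show "((\<lambda>s. (norm (U s (R (V \<tau> v))))\<^sup>2) has_vector_derivative ?g s \<tau>) (at s within {0..N})"
        by (simp add: power2_norm_eq_inner inner_commute)
    qed
    then show ?thesis by (simp add: U_0)
  qed
  have dt: "((\<lambda>\<tau>. ?g s \<tau>) has_integral (norm (U s (V t v)))\<^sup>2 - (norm (U s v))\<^sup>2) {0..t}" for s
  proof -
    have "((\<lambda>\<tau>. ?g s \<tau>) has_integral (norm (U s (V t v)))\<^sup>2 - (norm (U s (V 0 v)))\<^sup>2) {0..t}"
    proof (rule fundamental_theorem_of_calculus[OF t])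
      fix \<tau>
      from bounded_linear.has_vector_derivative[OF blinfun.bounded_linear_left V', of v]
      have "((\<lambda>\<tau>. V \<tau> v) has_vector_derivative - R (V \<tau> v)) (at \<tau> within {0..t})"
        by (simp add: blinfun.minus_left has_vector_derivative_at_within)
      from bounded_linear.has_vector_derivative[OF blinfun.bounded_linear_right[of "U s"] this]
      have d: "((\<lambda>\<tau>. U s (V \<tau> v)) has_vector_derivative - U s (R (V \<tau> v))) (at \<tau> within {0..t})"
        by (simp add: blinfun.minus_right)
      from bounded_bilinear.has_vector_derivative[OF bounded_bilinear_inner d d]
      show "((\<lambda>\<tau>. (norm (U s (V \<tau> v)))\<^sup>2) has_vector_derivative ?g s \<tau>) (at \<tau> within {0..t})"
        by (simp add: power2_norm_eq_inner inner_commute)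
    qed
    then show ?thesis by (simp add: V_0)
  qed
  \<comment> \<open>A finite N keeps the rectangle compact, so the order of integration may be
    exchanged for a continuous integrand. The boundary term at s = N is bounded by a multiple of
    \<open>?I\<close> itself that vanishes as N grows.\<close>
  have main: "?I \<le> K\<^sup>2 / (2 * w) * (norm (R v))\<^sup>2 + (K * exp (- (w * N)))\<^sup>2 * ?I" if N: "N \<ge> 0" for N
  proof -
    have "continuous_on (cbox (0, 0) (N, t)) (\<lambda>(s, \<tau>). ?g s \<tau>)"
      unfolding case_prod_unfold
      by (intro continuous_intros continuous_on_compose2[OF U_cont] continuous_on_compose2[OF V_cont])
        (auto simp: cbox_Pair_eq)
    from integral_swap_continuous[OF this]
    have swap: "integral {0..N} (\<lambda>s. integral {0..t} (?g s)) = integral {0..t} (\<lambda>\<tau>. integral {0..N} (\<lambda>s. ?g s \<tau>))"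
      by simp
    have cU: "continuous_on {0..N} (\<lambda>s. U s x)" for x
      by (intro continuous_intros continuous_on_subset[OF U_cont]) auto
    have "integral {0..N} (\<lambda>s. integral {0..t} (?g s)) \<ge> - (K\<^sup>2 / (2 * w) * (norm (R v))\<^sup>2)"
    proof -
      let ?e = "\<lambda>s. - (K\<^sup>2 * (norm (R v))\<^sup>2) * exp (- (2 * w * s))"
      have e: "(?e has_integral K\<^sup>2 * (norm (R v))\<^sup>2 / (2 * w) * exp (- (2 * w * N))
          - K\<^sup>2 * (norm (R v))\<^sup>2 / (2 * w) * exp (- (2 * w * 0))) {0..N}"
        by (rule fundamental_theorem_of_calculus[OF N])
          (use w in \<open>auto intro!: derivative_eq_intros simp flip: has_real_derivative_iff_has_vector_derivative\<close>)
      have "integral {0..N} ?e \<le> integral {0..N} (\<lambda>s. (norm (U s (V t v)))\<^sup>2 - (norm (U s v))\<^sup>2)"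
      proof (rule integral_le)
        show "?e integrable_on {0..N}" using e by (rule has_integral_integrable)
        show "(\<lambda>s. (norm (U s (V t v)))\<^sup>2 - (norm (U s v))\<^sup>2) integrable_on {0..N}"
          by (intro integrable_continuous_interval continuous_intros cU)
        fix s assume s: "s \<in> {0..N}"
        have "(norm (U s v))\<^sup>2 \<le> (K * exp (- (w * s)) * norm (R v))\<^sup>2"
          by (intro power_mono U_le) (use s in auto)
        also have "\<dots> = - ?e s" by (simp add: power_mult_distrib exp_double[symmetric])
        finally show "?e s \<le> (norm (U s (V t v)))\<^sup>2 - (norm (U s v))\<^sup>2" by (smt (verit) zero_le_power2)
      qed
      also have "\<dots> = integral {0..N} (\<lambda>s. integral {0..t} (?g s))"
        using integral_unique[OF dt] by simp
      finally have "K\<^sup>2 * (norm (R v))\<^sup>2 / (2 * w) * exp (- (2 * w * N)) - K\<^sup>2 * (norm (R v))\<^sup>2 / (2 * w)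
          \<le> integral {0..N} (\<lambda>s. integral {0..t} (?g s))"
        using integral_unique[OF e] by simp
      moreover have "K\<^sup>2 * (norm (R v))\<^sup>2 / (2 * w) * exp (- (2 * w * N)) \<ge> 0" using w by simp
      ultimately show ?thesis by (simp add: field_simps)
    qed
    also have "integral {0..N} (\<lambda>s. integral {0..t} (?g s)) =
        integral {0..t} (\<lambda>\<tau>. (norm (U N (R (V \<tau> v))))\<^sup>2 - (norm (R (R (V \<tau> v))))\<^sup>2)"
      unfolding swap using integral_unique[OF ds[OF N]] by simp
    also have "\<dots> \<le> integral {0..t} (\<lambda>\<tau>. ((K * exp (- (w * N)))\<^sup>2 - 1) * (norm (R (R (V \<tau> v))))\<^sup>2)"
    proof (rule integral_le)
      show "(\<lambda>\<tau>. (norm (U N (R (V \<tau> v))))\<^sup>2 - (norm (R (R (V \<tau> v))))\<^sup>2) integrable_on {0..t}"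
        "(\<lambda>\<tau>. ((K * exp (- (w * N)))\<^sup>2 - 1) * (norm (R (R (V \<tau> v))))\<^sup>2) integrable_on {0..t}"
        by (intro integrable_continuous_interval continuous_intros Vv_cont)+
      fix \<tau>
      have "(norm (U N (R (V \<tau> v))))\<^sup>2 \<le> (K * exp (- (w * N)) * norm (R (R (V \<tau> v))))\<^sup>2"
        by (intro power_mono U_le N) auto
      then show "(norm (U N (R (V \<tau> v))))\<^sup>2 - (norm (R (R (V \<tau> v))))\<^sup>2
          \<le> ((K * exp (- (w * N)))\<^sup>2 - 1) * (norm (R (R (V \<tau> v))))\<^sup>2"
        by (simp add: power_mult_distrib algebra_simps)
    qed
    also have "\<dots> = ((K * exp (- (w * N)))\<^sup>2 - 1) * ?I" by (rule integral_mult_right)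
    finally show ?thesis by (simp add: algebra_simps)
  qed
  \<comment> \<open>For N > 0 the factor \<open>N powr 0\<close> equals 1; it brings the exponential
    into the form of \<open>powr_exp_tendsto_0\<close>.\<close>
  have "((\<lambda>N. K\<^sup>2 / (2 * w) * (norm (R v))\<^sup>2 + (K * (N powr 0 * exp (- (w * N))))\<^sup>2 * ?I) \<longlongrightarrow>
      K\<^sup>2 / (2 * w) * (norm (R v))\<^sup>2 + (K * 0)\<^sup>2 * ?I) at_top"
    by (intro tendsto_intros powr_exp_tendsto_0 w)
  then have "?I \<le> K\<^sup>2 / (2 * w) * (norm (R v))\<^sup>2 + (K * 0)\<^sup>2 * ?I"
  proof (rule tendsto_lowerbound)
    show "\<forall>\<^sub>F N in at_top. ?I \<le> K\<^sup>2 / (2 * w) * (norm (R v))\<^sup>2 + (K * (N powr 0 * exp (- (w * N))))\<^sup>2 * ?I"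
      using eventually_gt_at_top[of 0]
    proof eventually_elim
      case (elim N)
      then show ?case using main[of N] by simp
    qed
  qed simp
  then show ?thesis by simp
qed

section \<open>The exponential of the inverse generator and an approximate identity\<close>

context exp_stable_semigroup
begin

abbreviation E :: "real \<Rightarrow> ('a \<Rightarrow>\<^sub>L 'a)" where "E t \<equiv> blinfun_exp (t *\<^sub>R (- R))"

lemma E_has_vector_derivative: "(E has_vector_derivative - (R o\<^sub>L E t)) (at t within S)"
  using blinfun_exp_scaleR_has_vector_derivative[of "- R" t S] by (simp add: blinfun_compose.minus_left)

lemma E_commute: "C o\<^sub>L R = R o\<^sub>L C \<Longrightarrow> C o\<^sub>L E t = E t o\<^sub>L C"
  by (rule blinfun_exp_commute)
    (simp add: blinfun_compose.scaleR_left blinfun_compose.scaleR_right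
      blinfun_compose.minus_left blinfun_compose.minus_right)

lemma E_add: "E (s + t) = E s o\<^sub>L E t"
  unfolding scaleR_add_left
  by (rule blinfun_exp_add)
    (simp add: blinfun_compose.scaleR_left blinfun_compose.scaleR_right
      blinfun_compose.minus_left blinfun_compose.minus_right)

lemma R_E_apply: "R (E t x) = E t (R x)"
  and W_E_apply: "a > 0 \<Longrightarrow> W a (E t x) = E t (W a x)"
  and W_R_apply: "a > 0 \<Longrightarrow> W a (R x) = R (W a x)"
  and T_R_apply: "s \<ge> 0 \<Longrightarrow> T s (R x) = R (T s x)"
proof -
  show "R (E t x) = E t (R x)" using E_commute[of R t] by (metis blinfun_apply_blinfun_compose)
  show "W a (E t x) = E t (W a x)" if "a > 0"
    using E_commute[OF W_W_commute[OF that, of 1], of t] by (metis blinfun_apply_blinfun_compose zero_less_one)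
  show "W a (R x) = R (W a x)" if "a > 0"
    using W_W_commute[OF that, of 1] by (metis blinfun_apply_blinfun_compose zero_less_one)
  show "T s (R x) = R (T s x)" if "s \<ge> 0"
    using T_W_commute[OF _ that, of 1] by (metis blinfun_apply_blinfun_compose zero_less_one)
qed

text \<open>For h > 0 this is the mean of T over {0..h}. Written in this way it visibly factors
  through \<open>R\<close>, so an estimate known on the range of \<open>R\<close> extends to all
  vectors by letting h tend to 0.\<close>

definition Q :: "real \<Rightarrow> ('a \<Rightarrow>\<^sub>L 'a)" where "Q h = (1 / h) *\<^sub>R (R - (R o\<^sub>L T h))"

lemma Q_apply: "h > 0 \<Longrightarrow> Q h x = (1 / h) *\<^sub>R (R x - T h (R x))"
  and Q_R: "Q h x = R ((1 / h) *\<^sub>R (x - T h x))"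
  by (simp_all add: Q_def T_R_apply blinfun.scaleR_left blinfun.diff_left blinfun.scaleR_right blinfun.diff_right)

lemma norm_Q: "h > 0 \<Longrightarrow> norm (Q h) \<le> K"
  by (rule norm_blinfun_bound) (use K_pos norm_difference_quotient_R in \<open>auto simp: Q_apply\<close>)

lemma norm_Q_apply: "h > 0 \<Longrightarrow> norm (Q h x) \<le> K * norm x"
  by (rule order_trans[OF norm_blinfun mult_right_mono[OF norm_Q]]) auto

lemma Q_tendsto: "((\<lambda>h. Q h x) \<longlongrightarrow> x) (at_right 0)"
  by (rule Lim_transform_eventually[OF difference_quotient_R])
    (auto simp: eventually_at_filter Q_apply)

end

section \<open>Energy bounds for the exponential and its adjoint\<close>

locale hilbert_exp_stable_semigroup = exp_stable_semigroup T K w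
  for T :: "real \<Rightarrow> ('a::{real_inner, banach} \<Rightarrow>\<^sub>L 'a)" and K w
begin

lemma energy_primal:
  assumes "t \<ge> 0"
  shows "integral {0..t} (\<lambda>\<tau>. (norm (R (R (E \<tau> v))))\<^sup>2) \<le> K\<^sup>2 / (2 * w) * (norm (R v))\<^sup>2"
proof (rule energy_estimate[where U = "\<lambda>s. T s o\<^sub>L R"])
  show "((\<lambda>s. (T s o\<^sub>L R) o\<^sub>L R) has_vector_derivative - (T s o\<^sub>L R)) (at s within {0..})" if "s \<ge> 0" for s
    using T_R_R_has_vector_derivative[OF that] by (simp add: blinfun_compose_assoc)
  show "norm ((T s o\<^sub>L R) v) \<le> K * exp (- (w * s)) * norm (R v)" if "s \<ge> 0" for s v
    using norm_T_apply[OF that] by simp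
qed (use assms w_pos R_continuous E_has_vector_derivative in auto)

text \<open>Every family is replaced by its adjoint. Only norm derivatives and norm bounds are
  transported, so strong continuity of the adjoint semigroup never enters.\<close>

lemma energy_dual:
  assumes "t \<ge> 0"
  shows "integral {0..t} (\<lambda>\<tau>. (norm (adj R (adj R (adj (E \<tau>) v))))\<^sup>2) \<le> K\<^sup>2 / (2 * w) * (norm (adj R v))\<^sup>2"
proof (rule energy_estimate[where U = "\<lambda>s. adj (T s o\<^sub>L R)"])
  note lin = bounded_linear_adj
  show "((\<lambda>s. adj (T s o\<^sub>L R) o\<^sub>L adj R) has_vector_derivative - adj (T s o\<^sub>L R)) (at s within {0..})" if "s \<ge> 0" for s
  proof -
    have "((\<lambda>s. adj (T s o\<^sub>L (R o\<^sub>L R))) has_vector_derivative adj (- (T s o\<^sub>L R))) (at s within {0..})"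
      by (rule bounded_linear.has_vector_derivative[OF lin T_R_R_has_vector_derivative[OF that]])
    then have "((\<lambda>s. adj (T s o\<^sub>L (R o\<^sub>L R))) has_vector_derivative - adj (T s o\<^sub>L R)) (at s within {0..})"
      by (simp add: linear_neg bounded_linear.linear[OF lin])
    then show ?thesis
    proof (rule has_vector_derivative_transform[rotated 2])
      show "adj (T r o\<^sub>L R) o\<^sub>L adj R = adj (T r o\<^sub>L (R o\<^sub>L R))" if "r \<in> {0..}" for r
      proof -
        have "R o\<^sub>L (T r o\<^sub>L R) = T r o\<^sub>L (R o\<^sub>L R)"
          using T_W_commute[of 1 r] that by (metis atLeast_iff blinfun_compose_assoc zero_less_one)
        then show ?thesis by (simp flip: adj_compose)
      qed
    qed (use that in simp)
  qed
  show "continuous_on {0..} (\<lambda>s. adj (T s o\<^sub>L R))"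
    by (rule bounded_linear.continuous_on[OF lin R_continuous])
  show "norm (adj (T s o\<^sub>L R) v) \<le> K * exp (- (w * s)) * norm (adj R v)" if "s \<ge> 0" for s v
  proof -
    have "adj (T s o\<^sub>L R) = adj (T s) o\<^sub>L adj R"
      using T_W_commute[of 1 s] that by (simp flip: adj_compose)
    then have "norm (adj (T s o\<^sub>L R) v) \<le> norm (adj (T s)) * norm (adj R v)" by (simp add: norm_blinfun)
    also have "\<dots> \<le> K * exp (- (w * s)) * norm (adj R v)"
      by (intro mult_right_mono order_trans[OF norm_adj_le norm_T_exp[OF that]]) auto
    finally show ?thesis .
  qed
  show "((\<lambda>\<tau>. adj (E \<tau>)) has_vector_derivative - (adj R o\<^sub>L adj (E t))) (at t)" for t
  proof -
    have "((\<lambda>\<tau>. adj (E \<tau>)) has_vector_derivative adj (- (R o\<^sub>L E t))) (at t)"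
      by (rule bounded_linear.has_vector_derivative[OF lin E_has_vector_derivative])
    then show ?thesis
      using E_commute[of R t] by (simp add: linear_neg bounded_linear.linear[OF lin] flip: adj_compose)
  qed
  show "adj (E 0) = id_blinfun"
    by (rule blinfun_eqI, rule vector_eq_ldot[THEN iffD1]) (simp flip: adj_inner)
qed (use assms w_pos in \<open>auto simp: adj_compose\<close>)

text \<open>The inner product \<open>?p \<tau> \<bullet> ?q (t - \<tau>)\<close> does not depend on
  \<tau>, so integrating it over {0..t} produces the factor t. Each of the two energies consumes two
  copies of \<open>R\<close>, hence the four in the statement.\<close>

lemma bilinear_estimate:
  assumes t: "t > 0"
  shows "t * \<bar>E t (R (R (R (R v)))) \<bullet> u\<bar> \<le> K\<^sup>2 / (4 * w) * ((norm (R v))\<^sup>2 + (norm (adj R u))\<^sup>2)"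
proof -
  let ?c = "\<bar>E t (R (R (R (R v)))) \<bullet> u\<bar>"
  let ?p = "\<lambda>\<tau>. R (R (E \<tau> v))" and ?q = "\<lambda>\<tau>. adj R (adj R (adj (E \<tau>) u))"
  have E_cont: "continuous_on A E" for A
    using has_vector_derivative_continuous[OF E_has_vector_derivative]
    by (auto simp: continuous_on_eq_continuous_within)
  have cp: "continuous_on A (\<lambda>\<tau>. (norm (?p \<tau>))\<^sup>2)" for A
    by (intro continuous_intros E_cont)
  have cq: "continuous_on A (\<lambda>\<tau>. (norm (?q \<tau>))\<^sup>2)" for A
    by (intro continuous_intros bounded_linear.continuous_on[OF bounded_linear_adj E_cont])
  have ip: "(\<lambda>\<tau>. 1/2 * (norm (?p \<tau>))\<^sup>2) integrable_on {0..t}"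
    by (intro integrable_continuous_interval continuous_on_mult continuous_on_const cp)
  have iq: "(\<lambda>\<tau>. 1/2 * (norm (?q (t - \<tau>)))\<^sup>2) integrable_on {0..t}"
    by (intro integrable_continuous_interval continuous_on_mult continuous_on_const
        continuous_on_compose2[OF cq[of UNIV]] continuous_intros) auto
  have "?c \<le> 1/2 * (norm (?p \<tau>))\<^sup>2 + 1/2 * (norm (?q (t - \<tau>)))\<^sup>2" for \<tau>
  proof -
    have "E t = E (t - \<tau>) o\<^sub>L E \<tau>" using E_add[of "t - \<tau>" \<tau>] by simp
    then have "E t (R (R (R (R v)))) \<bullet> u = ?p \<tau> \<bullet> ?q (t - \<tau>)"
      by (simp only: R_E_apply blinfun_apply_blinfun_compose flip: adj_inner)
    then have "?c \<le> norm (?p \<tau>) * norm (?q (t - \<tau>))" by (simp add: Cauchy_Schwarz_ineq2)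
    also have "\<dots> \<le> 1/2 * (norm (?p \<tau>))\<^sup>2 + 1/2 * (norm (?q (t - \<tau>)))\<^sup>2"
      using sum_squares_bound[of "norm (?p \<tau>)" "norm (?q (t - \<tau>))"] by simp
    finally show ?thesis .
  qed
  then have "integral {0..t} (\<lambda>_. ?c) \<le> integral {0..t} (\<lambda>\<tau>. 1/2 * (norm (?p \<tau>))\<^sup>2 + 1/2 * (norm (?q (t - \<tau>)))\<^sup>2)"
    by (intro integral_le integrable_add ip iq) auto
  also have "\<dots> = 1/2 * integral {0..t} (\<lambda>\<tau>. (norm (?p \<tau>))\<^sup>2) + 1/2 * integral {0..t} (\<lambda>\<tau>. (norm (?q (t - \<tau>)))\<^sup>2)"
    unfolding integral_add[OF ip iq] by (simp only: integral_mult_right)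
  also have "integral {0..t} (\<lambda>\<tau>. (norm (?q (t - \<tau>)))\<^sup>2) = integral {0..t} (\<lambda>\<tau>. (norm (?q \<tau>))\<^sup>2)"
    by (rule integral_reflect_interval)
  also have "1/2 * integral {0..t} (\<lambda>\<tau>. (norm (?p \<tau>))\<^sup>2) + 1/2 * \<dots> \<le>
      1/2 * (K\<^sup>2 / (2 * w) * (norm (R v))\<^sup>2) + 1/2 * (K\<^sup>2 / (2 * w) * (norm (adj R u))\<^sup>2)"
    by (intro add_mono mult_left_mono energy_primal energy_dual) (use t in auto)
  finally show ?thesis using t w_pos by (simp add: field_simps)
qed

lemma norm_E_R2:
  assumes t: "t > 0"
  shows "norm (E t (R (R x))) \<le> (K ^ 4 / 2) / (t * w) * norm x"
proof -
  let ?G = "\<lambda>x. E t (R (R x))"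
  have bound: "t * \<bar>?G x \<bullet> y\<bar> \<le> K ^ 4 / (4 * w) * ((norm x)\<^sup>2 + (norm y)\<^sup>2)" for x y
  proof -
    have "((\<lambda>h. t * \<bar>Q h (?G (Q h x)) \<bullet> y\<bar>) \<longlongrightarrow> t * \<bar>?G x \<bullet> y\<bar>) (at_right 0)"
    proof -
      have lim: "((\<lambda>h. K * norm (?G (Q h x) - ?G x) + norm (Q h (?G x) - ?G x)) \<longlongrightarrow> K * 0 + 0) (at_right 0)"
        by (intro tendsto_intros tendsto_norm_zero LIM_zero Q_tendsto)
      have "((\<lambda>h. Q h (?G (Q h x)) - ?G x) \<longlongrightarrow> 0) (at_right 0)"
      proof (rule Lim_null_comparison)
        show "((\<lambda>h. K * norm (?G (Q h x) - ?G x) + norm (Q h (?G x) - ?G x)) \<longlongrightarrow> 0) (at_right 0)"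
          using lim by simp
        show "\<forall>\<^sub>F h in at_right 0. norm (Q h (?G (Q h x)) - ?G x)
            \<le> K * norm (?G (Q h x) - ?G x) + norm (Q h (?G x) - ?G x)"
          unfolding eventually_at_filter
        proof (intro always_eventually allI impI)
          fix h :: real assume "h \<in> {0<..}"
          then have "norm (Q h (?G (Q h x) - ?G x)) \<le> K * norm (?G (Q h x) - ?G x)"
            by (intro norm_Q_apply) auto
          then show "norm (Q h (?G (Q h x)) - ?G x) \<le> K * norm (?G (Q h x) - ?G x) + norm (Q h (?G x) - ?G x)"
            using norm_triangle_ineq[of "Q h (?G (Q h x) - ?G x)" "Q h (?G x) - ?G x"]
            by (simp add: blinfun.diff_right)
        qed
      qed
      then have "((\<lambda>h. Q h (?G (Q h x))) \<longlongrightarrow> ?G x) (at_right 0)" by (rule LIM_zero_cancel)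
      then show ?thesis by (intro tendsto_mult tendsto_const tendsto_rabs tendsto_inner)
    qed
    then show ?thesis
    proof (rule tendsto_upperbound)
      show "\<forall>\<^sub>F h in at_right 0. t * \<bar>Q h (?G (Q h x)) \<bullet> y\<bar> \<le> K ^ 4 / (4 * w) * ((norm x)\<^sup>2 + (norm y)\<^sup>2)"
        unfolding eventually_at_filter
      proof (intro always_eventually allI impI)
        fix h :: real assume "h \<in> {0<..}"
        then have h: "h > 0" by simp
        \<comment> \<open>Chosen so that \<open>R ?v\<close> and \<open>?D o\<^sub>L R\<close> both
          produce \<open>Q h\<close>. Two of the four copies of \<open>R\<close> are thus absorbed
          at a cost of K each, and \<open>R o\<^sub>L R\<close> remains.\<close>
        let ?v = "(1 / h) *\<^sub>R (x - T h x)" and ?D = "(1 / h) *\<^sub>R (id_blinfun - T h)"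
        have Rv: "R ?v = Q h x" by (simp add: Q_R)
        have "Q h = ?D o\<^sub>L R"
          by (rule blinfun_eqI) (simp add: Q_apply[OF h] blinfun.scaleR_left blinfun.diff_left)
        then have adjQ: "adj R (adj ?D y) = adj (Q h) y" by (simp add: adj_compose)
        have "Q h (?G (Q h x)) \<bullet> y = E t (R (R (R (R ?v)))) \<bullet> adj ?D y"
        proof -
          have "Q h (?G (Q h x)) = ?D (E t (R (R (R (R ?v)))))"
            unfolding Rv \<open>Q h = ?D o\<^sub>L R\<close> blinfun_apply_blinfun_compose R_E_apply ..
          then show ?thesis by (simp add: adj_inner)
        qed
        then have "t * \<bar>Q h (?G (Q h x)) \<bullet> y\<bar> \<le> K\<^sup>2 / (4 * w) * ((norm (Q h x))\<^sup>2 + (norm (adj (Q h) y))\<^sup>2)"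
          using bilinear_estimate[OF t, of ?v "adj ?D y"] unfolding Rv adjQ by simp
        also have "\<dots> \<le> K\<^sup>2 / (4 * w) * ((K * norm x)\<^sup>2 + (K * norm y)\<^sup>2)"
        proof (intro mult_left_mono add_mono power_mono norm_Q_apply h)
          show "norm (adj (Q h) y) \<le> K * norm y"
            by (rule order_trans[OF norm_blinfun mult_right_mono[OF order_trans[OF norm_adj_le norm_Q[OF h]]]]) auto
        qed (use w_pos in auto)
        also have "\<dots> = K ^ 4 / (4 * w) * ((norm x)\<^sup>2 + (norm y)\<^sup>2)"
          using w_pos by (simp add: field_simps power_mult_distrib power4_eq_xxxx power2_eq_square)
        finally show "t * \<bar>Q h (?G (Q h x)) \<bullet> y\<bar> \<le> K ^ 4 / (4 * w) * ((norm x)\<^sup>2 + (norm y)\<^sup>2)" .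
      qed
    qed simp
  qed
  show ?thesis
  proof (cases "?G x = 0 \<or> x = 0")
    case True
    then show ?thesis
    proof
      assume "?G x = 0"
      then show ?thesis using t w_pos by simp
    qed (simp add: blinfun.zero_right)
  next
    case False
    let ?g = "norm (?G x)" and ?n = "norm x"
    have pos: "?g > 0" "?n > 0" using False by auto
    \<comment> \<open>Aligned with \<open>?G x\<close> and of the same length as x, so that the sum
      of squares equals twice the product of the norms.\<close>
    let ?y = "(?n / ?g) *\<^sub>R ?G x"
    have "?G x \<bullet> ?y = ?n * ?g"
      using pos by (simp add: dot_square_norm power2_eq_square)
    moreover have "norm ?y = ?n" using pos by simp
    ultimately have "t * (?n * ?g) \<le> K ^ 4 / (4 * w) * (?n\<^sup>2 + ?n\<^sup>2)"
      using bound[of x ?y] pos by simp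
    then have "(t * ?g) * ?n \<le> (K ^ 4 / (2 * w) * ?n) * ?n"
      by (simp add: power2_eq_square mult_ac)
    then have "t * ?g \<le> K ^ 4 / (2 * w) * ?n" using pos mult_right_le_imp_le by blast
    then show ?thesis using t w_pos by (simp add: field_simps)
  qed
qed

end

section \<open>Decay of the exponential of the inverse generator\<close>

context hilbert_exp_stable_semigroup
begin

lemma E_half: "E t x = E (t / 2) (E (t / 2) x)"
  using E_add[of "t / 2" "t / 2"] by simp

lemma norm_E_R4:
  assumes t: "t > 0"
  shows "norm (E t (R (R (R (R x))))) \<le> K ^ 8 / (t * w)\<^sup>2 * norm x"
proof -
  have "norm (E t (R (R (R (R x))))) = norm (E (t / 2) (R (R (E (t / 2) (R (R x))))))"
    by (simp only: R_E_apply E_half[of t])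
  also have "\<dots> \<le> (K ^ 4 / 2) / (t / 2 * w) * norm (E (t / 2) (R (R x)))"
    by (rule norm_E_R2) (use t in simp)
  also have "\<dots> \<le> (K ^ 4 / 2) / (t / 2 * w) * ((K ^ 4 / 2) / (t / 2 * w) * norm x)"
    by (intro mult_left_mono norm_E_R2) (use t w_pos in auto)
  also have "\<dots> = K ^ 8 / (t * w)\<^sup>2 * norm x"
    using t w_pos by (simp add: power2_eq_square flip: power_add)
  finally show ?thesis .
qed

text \<open>What \<open>moment_inequality\<close> and \<open>landau_inequality\<close> make of the
  constants K^4/2 and K^8. It depends on K and a but not on w, hence is common to all
  shifts.\<close>

definition decay_const :: "real \<Rightarrow> real" where
  "decay_const a = (K * (K ^ 4 / 2) / a + 2 * K * (K * (K ^ 4 / 2) + (K + 1) * K ^ 8)) / Gamma a"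

lemma decay_const_pos: "a > 0 \<Longrightarrow> decay_const a > 0"
  unfolding decay_const_def using K_pos Gamma_real_pos[of a]
  by (intro divide_pos_pos add_pos_pos mult_pos_pos zero_less_power) auto

lemma norm_W_E_R2:
  assumes a: "0 < a" "a \<le> 1" and t: "t > 0"
  shows "norm (W a (E t (R (R x)))) \<le> decay_const a * (t * w) powr (- 1 - a / 2) * norm x"
proof -
  define r where "r = t * w"
  have r: "r > 0" using t w_pos by (simp add: r_def)
  \<comment> \<open>This value balances both interpolations: in the first the two terms become
    r^(-3/2), in the second r^(-1-a/2).\<close>
  define d where "d = r powr (- 1 / 2)"
  have d: "d > 0" using r by (simp add: d_def)
  let ?z = "E t (R (R x))" and ?n = "norm x"
  have z: "norm ?z \<le> (K ^ 4 / 2) * r powr - 1 * ?n"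
  proof -
    have "r powr - 1 = 1 / r" using r by (simp add: powr_minus_divide)
    then show ?thesis using norm_E_R2[OF t, of x, folded r_def] by simp
  qed
  have RRz: "norm (R (R ?z)) \<le> K ^ 8 * r powr - 2 * ?n"
  proof -
    have "r powr - 2 = 1 / r\<^sup>2" using r by (simp add: powr_minus_divide)
    moreover have "norm (R (R ?z)) \<le> K ^ 8 / r\<^sup>2 * norm x"
      using norm_E_R4[OF t, of x, folded r_def] by (simp only: R_E_apply)
    ultimately show ?thesis by simp
  qed
  have "norm (R ?z) \<le> K * d * norm ?z + (K + 1) / d * norm (R (R ?z))"
    by (rule landau_inequality[OF d])
  also have "\<dots> \<le> K * d * ((K ^ 4 / 2) * r powr - 1 * ?n) + (K + 1) / d * (K ^ 8 * r powr - 2 * ?n)"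
    by (intro add_mono mult_left_mono z RRz) (use d K_pos in auto)
  also have "\<dots> = (K * (K ^ 4 / 2)) * (d * r powr - 1) * ?n + ((K + 1) * K ^ 8) * (r powr - 2 / d) * ?n"
    by (simp only: divide_inverse mult_ac)
  also have "d * r powr - 1 = r powr (- 3 / 2)"
    unfolding d_def using powr_add[of r "- 1 / 2" "- 1"] by simp
  also have "r powr - 2 / d = r powr (- 3 / 2)"
    unfolding d_def using powr_diff[of r "- 2" "- 1 / 2"] by simp
  finally have Rz: "norm (R ?z) \<le> (K * (K ^ 4 / 2) + (K + 1) * K ^ 8) * r powr (- 3 / 2) * ?n"
    by (simp add: algebra_simps)
  have "Gamma a * norm (W a ?z) \<le> K * d powr a / a * norm ?z + 2 * K * d powr (a - 1) * norm (R ?z)"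
    by (rule moment_inequality[OF a d])
  also have "\<dots> \<le> K * d powr a / a * ((K ^ 4 / 2) * r powr - 1 * ?n) +
      2 * K * d powr (a - 1) * ((K * (K ^ 4 / 2) + (K + 1) * K ^ 8) * r powr (- 3 / 2) * ?n)"
    by (intro add_mono mult_left_mono z Rz) (use a K_pos in auto)
  also have "\<dots> = (K * (K ^ 4 / 2) / a) * (d powr a * r powr - 1) * ?n +
      (2 * K * (K * (K ^ 4 / 2) + (K + 1) * K ^ 8)) * (d powr (a - 1) * r powr (- 3 / 2)) * ?n"
    by (simp only: divide_inverse mult_ac)
  also have "d powr a * r powr - 1 = r powr (- 1 - a / 2)"
  proof -
    have "- 1 / 2 * a + - 1 = - 1 - a / 2" by simp
    then show ?thesis unfolding d_def powr_powr by (simp only: flip: powr_add)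
  qed
  also have "d powr (a - 1) * r powr (- 3 / 2) = r powr (- 1 - a / 2)"
  proof -
    have "- 1 / 2 * (a - 1) + - 3 / 2 = - 1 - a / 2" by (simp add: field_simps)
    then show ?thesis unfolding d_def powr_powr by (simp only: flip: powr_add)
  qed
  also have "(K * (K ^ 4 / 2) / a) * r powr (- 1 - a / 2) * ?n +
      (2 * K * (K * (K ^ 4 / 2) + (K + 1) * K ^ 8)) * r powr (- 1 - a / 2) * ?n =
      Gamma a * (decay_const a * r powr (- 1 - a / 2) * ?n)"
    using Gamma_real_pos[OF a(1)] by (simp add: decay_const_def distrib_right)
  finally show ?thesis
    using Gamma_real_pos[OF a(1)] by (simp add: r_def)
qed

text \<open>The t-derivative has one more \<open>R\<close>, so its size is t^(-1-a/2); integrating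
  from t to infinity gives 2/a and the power t^(-a/2). On vectors \<open>R v\<close> the value at
  infinity is known to be 0, and \<open>Q h\<close> extends the bound to all y.\<close>

lemma norm_W_E_R:
  assumes a: "0 < a" "a \<le> 1" and t: "t > 0"
  shows "norm (W a (E t (R y))) \<le> decay_const a * w powr (- 1 - a / 2) * (2 / a) * t powr (- a / 2) * norm y"
proof -
  let ?D = "decay_const a * w powr (- 1 - a / 2) * (2 / a)"
  let ?g = "\<lambda>s x. W a (E s (R x))"
  have R2: "norm (W a (R (E s (R x)))) \<le> decay_const a * w powr (- 1 - a / 2) * s powr (- 1 - a / 2) * norm x" if "s > 0" for s x
  proof -
    have "norm (W a (R (E s (R x)))) \<le> decay_const a * (s * w) powr (- 1 - a / 2) * norm x"
      using norm_W_E_R2[OF a that, of x] by (simp only: R_E_apply)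
    then show ?thesis using that w_pos by (simp add: powr_mult mult_ac)
  qed
  have on_range: "norm (?g t (R v)) \<le> ?D * t powr (- a / 2) * norm (R v)" for v
  proof -
    let ?\<phi> = "\<lambda>s. - (?D * norm (R v) * s powr (- a / 2))"
    have le: "norm (?g N (R v) - ?g t (R v)) \<le> ?D * t powr (- a / 2) * norm (R v)" if "N > t" for N
    proof -
      have "norm (?g N (R v) - ?g t (R v)) \<le> ?\<phi> N - ?\<phi> t"
      proof (rule differentiable_bound_general[OF that])
        have d: "((\<lambda>s. ?g s (R v)) has_vector_derivative - W a (R (E s (R (R v))))) (at s)" for s
        proof -
          from bounded_linear.has_vector_derivative[OF blinfun.bounded_linear_left E_has_vector_derivative, of "R (R v)"]
          have "((\<lambda>s. E s (R (R v))) has_vector_derivative - R (E s (R (R v)))) (at s)"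
            by (simp add: blinfun.minus_left)
          from bounded_linear.has_vector_derivative[OF blinfun.bounded_linear_right[of "W a"] this]
          show ?thesis by (simp add: blinfun.minus_right)
        qed
        show "((\<lambda>s. ?g s (R v)) has_vector_derivative - W a (R (E s (R (R v))))) (at s)" for s by (rule d)
        show "continuous_on {t..N} (\<lambda>s. ?g s (R v))"
          using has_vector_derivative_continuous[OF d] continuous_at_imp_continuous_on by blast
        show "continuous_on {t..N} ?\<phi>"
          by (intro continuous_intros) (use t in auto)
        fix s assume "t < s"
        then have s: "s > 0" using t by simp
        have "(?\<phi> has_real_derivative - (?D * norm (R v) * (- a / 2 * s powr (- a / 2 - 1)))) (at s)"
          by (intro DERIV_minus DERIV_cmult has_real_derivative_powr s)
        then show "(?\<phi> has_vector_derivative decay_const a * w powr (- 1 - a / 2) * s powr (- 1 - a / 2) * norm (R v)) (at s)"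
        proof -
          have e: "- 1 - a / 2 = - a / 2 - 1" by simp
          show ?thesis
            using \<open>(?\<phi> has_real_derivative _) _\<close> a unfolding e
            by (simp add: has_real_derivative_iff_has_vector_derivative mult_ac)
        qed
        show "norm (- W a (R (E s (R (R v))))) \<le> decay_const a * w powr (- 1 - a / 2) * s powr (- 1 - a / 2) * norm (R v)"
          using R2[OF s, of "R v"] by simp
      qed
      moreover have "?D * norm (R v) * N powr (- a / 2) \<ge> 0"
        using decay_const_pos[OF a(1)] a by simp
      ultimately show ?thesis by (simp add: mult_ac)
    qed
    have lim: "((\<lambda>N. ?g N (R v)) \<longlongrightarrow> 0) at_top"
    proof (rule Lim_null_comparison)
      have "((\<lambda>N. decay_const a * w powr (- 1 - a / 2) * N powr (- 1 - a / 2) * norm v) \<longlongrightarrow>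
          decay_const a * w powr (- 1 - a / 2) * 0 * norm v) at_top"
        by (intro tendsto_intros tendsto_neg_powr filterlim_ident) (use a in auto)
      then show "((\<lambda>N. decay_const a * w powr (- 1 - a / 2) * N powr (- 1 - a / 2) * norm v) \<longlongrightarrow> 0) at_top" by simp
      show "\<forall>\<^sub>F N in at_top. norm (?g N (R v)) \<le> decay_const a * w powr (- 1 - a / 2) * N powr (- 1 - a / 2) * norm v"
        using eventually_gt_at_top[of 0]
      proof eventually_elim
        case (elim N)
        then show ?case using R2[OF elim, of v] by (simp only: R_E_apply)
      qed
    qed
    have "norm (0 - ?g t (R v)) \<le> ?D * t powr (- a / 2) * norm (R v)"
    proof (rule tendsto_upperbound[OF tendsto_norm[OF tendsto_diff[OF lim tendsto_const]]])
      show "\<forall>\<^sub>F N in at_top. norm (?g N (R v) - ?g t (R v)) \<le> ?D * t powr (- a / 2) * norm (R v)"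
        using eventually_gt_at_top[of t] by eventually_elim (rule le)
    qed simp
    then show ?thesis by simp
  qed
  have 1: "((\<lambda>h. norm (?g t (Q h y))) \<longlongrightarrow> norm (?g t y)) (at_right 0)"
    by (intro tendsto_norm bounded_linear.tendsto[OF blinfun.bounded_linear_right] Q_tendsto)
  have 2: "((\<lambda>h. ?D * t powr (- a / 2) * norm (Q h y)) \<longlongrightarrow> ?D * t powr (- a / 2) * norm y) (at_right 0)"
    by (intro tendsto_mult tendsto_const tendsto_norm Q_tendsto)
  have 3: "norm (?g t (Q h y)) \<le> ?D * t powr (- a / 2) * norm (Q h y)" for h
    unfolding Q_R by (rule on_range)
  show ?thesis
    by (rule tendsto_le[OF trivial_limit_at_right_real 2 1 always_eventually[OF allI[OF 3]]])
qed

end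

section \<open>Dependence on the shift\<close>

lemma exp_second_order_remainder:
  fixes x y :: real
  assumes "x \<ge> 0" "y \<ge> 0"
  shows "\<bar>exp (- y) - exp (- x) + (y - x) * exp (- x)\<bar> \<le> (y - x)\<^sup>2"
proof -
  have tangent: "exp (- v) \<ge> exp (- u) - (v - u) * exp (- u)" for u v :: real
  proof -
    have "exp (- u) * (1 + (u - v)) \<le> exp (- u) * exp (u - v)"
      by (intro mult_left_mono exp_ge_add_one_self) auto
    then show ?thesis by (simp add: algebra_simps flip: exp_add)
  qed
  have lip: "\<bar>exp (- x) - exp (- y)\<bar> \<le> \<bar>y - x\<bar>"
  proof -
    have "exp (- u) - exp (- v) \<le> v - u" if "u \<ge> 0" "u \<le> v" for u v :: real
    proof -
      have "exp (- u) - exp (- v) \<le> (v - u) * exp (- u)" using tangent[of u v] by simp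
      also have "\<dots> \<le> (v - u) * 1" using that by (intro mult_left_mono) auto
      finally show ?thesis by simp
    qed
    moreover have "exp (- v) \<le> exp (- u)" if "u \<le> v" for u v :: real using that by simp
    ultimately show ?thesis using assms by (cases "x \<le> y") (auto simp: abs_if)
  qed
  \<comment> \<open>Convexity is used twice: the tangent at x makes the remainder nonnegative, and
    the tangent at y bounds it by a product of increments.\<close>
  have "exp (- y) - exp (- x) + (y - x) * exp (- x) \<le> (y - x) * (exp (- x) - exp (- y))"
    using tangent[of x y] tangent[of y x] by (simp add: algebra_simps)
  also have "\<dots> \<le> \<bar>y - x\<bar> * \<bar>exp (- x) - exp (- y)\<bar>" by (simp flip: abs_mult)
  also have "\<dots> \<le> \<bar>y - x\<bar> * \<bar>y - x\<bar>" by (intro mult_left_mono lip) auto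
  finally show ?thesis using tangent[of x y] by (simp add: power2_eq_square)
qed

context exp_stable_semigroup
begin

text \<open>The semigroup generated by A - \<xi>.\<close>

definition S :: "real \<Rightarrow> real \<Rightarrow> ('a \<Rightarrow>\<^sub>L 'a)" where "S \<xi> s = exp (- (\<xi> * s)) *\<^sub>R T s"

lemma S_0: "S 0 = T" by (simp add: S_def fun_eq_iff)

lemma shifted_semigroup:
  assumes "\<xi> \<ge> 0"
  shows "exp_stable_semigroup (S \<xi>) K (w + \<xi>)"
proof
  show "c0_semigroup (S \<xi>)"
    unfolding c0_semigroup_def
  proof (intro conjI allI impI)
    show "S \<xi> 0 = id_blinfun" by (simp add: S_def)
    show "S \<xi> (s + t) = S \<xi> s o\<^sub>L S \<xi> t" if "0 \<le> s" "0 \<le> t" for s t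
      by (simp add: S_def T_add[OF that] blinfun_compose.scaleR_left blinfun_compose.scaleR_right
          distrib_left flip: exp_add)
    show "((\<lambda>t. S \<xi> t x) \<longlongrightarrow> x) (at_right 0)" for x
    proof -
      have "((\<lambda>t. exp (- (\<xi> * t)) *\<^sub>R T t x) \<longlongrightarrow> exp (- (\<xi> * 0)) *\<^sub>R x) (at_right 0)"
        by (intro tendsto_intros T_tendsto)
      then show ?thesis by (simp add: S_def blinfun.scaleR_left)
    qed
  qed
  show "norm (S \<xi> t) \<le> K * exp (- ((w + \<xi>) * t))" if "t \<ge> 0" for t
  proof -
    have "norm (S \<xi> t) = exp (- (\<xi> * t)) * norm (T t)" by (simp add: S_def)
    also have "\<dots> \<le> exp (- (\<xi> * t)) * (K * exp (- (w * t)))"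
      by (intro mult_left_mono norm_T_exp that) auto
    also have "\<dots> = K * exp (- ((w + \<xi>) * t))"
      by (simp add: distrib_right exp_diff exp_minus field_simps)
    finally show ?thesis .
  qed
qed (use assms K_pos w_pos in auto)

lemma shifted_W_commute:
  assumes "\<xi> \<ge> 0" "a > 0" "\<And>s. s > 0 \<Longrightarrow> D o\<^sub>L T s = T s o\<^sub>L D"
  shows "D o\<^sub>L neg_frac_pow (S \<xi>) a = neg_frac_pow (S \<xi>) a o\<^sub>L D"
  by (rule exp_stable_semigroup.W_commute[OF shifted_semigroup[OF assms(1)] assms(2)])
    (simp add: S_def blinfun_compose.scaleR_left blinfun_compose.scaleR_right assms(3))

text \<open>Powers for different shifts are integrals of one and the same semigroup. This supplies
  the commutativity needed to differentiate the exponential in \<xi>.\<close>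

lemma shifted_W_W_commute:
  assumes "\<xi> \<ge> 0" "a > 0" "\<eta> \<ge> 0" "b > 0"
  shows "neg_frac_pow (S \<eta>) b o\<^sub>L neg_frac_pow (S \<xi>) a = neg_frac_pow (S \<xi>) a o\<^sub>L neg_frac_pow (S \<eta>) b"
  by (intro shifted_W_commute shifted_W_commute[symmetric] T_commute assms) auto

text \<open>Differentiation under the integral: the factor -s from exp(-\<xi>s) raises the exponent
  by one, and Gamma (a + 1) / Gamma a equals a. The remainder has a weight of order (\<eta> -
  \<xi>)^2 s^(a+1), integrable against the decay of \<open>T\<close> itself, so the limit holds in
  operator norm.\<close>

lemma shifted_W_has_vector_derivative:
  assumes \<xi>: "\<xi> \<ge> 0" and a: "a > 0"
  shows "((\<lambda>\<xi>. neg_frac_pow (S \<xi>) a) has_vector_derivative - (a *\<^sub>R neg_frac_pow (S \<xi>) (a + 1))) (at \<xi> within {0..})"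
proof (rule has_vector_derivative_quadratic)
  fix \<eta> :: real assume "\<eta> \<in> {0..}"
  then have \<eta>: "\<eta> \<ge> 0" by simp
  interpret X: exp_stable_semigroup "S \<xi>" K "w + \<xi>" by (rule shifted_semigroup[OF \<xi>])
  interpret Y: exp_stable_semigroup "S \<eta>" K "w + \<eta>" by (rule shifted_semigroup[OF \<eta>])
  let ?c = "K * (Gamma (a + 2) / w powr (a + 2)) / Gamma a"
  have G: "Gamma a > 0" using a by (rule Gamma_real_pos)
  show "norm (Y.W a - X.W a - (\<eta> - \<xi>) *\<^sub>R (- (a *\<^sub>R X.W (a + 1)))) \<le> ?c * (\<eta> - \<xi>)\<^sup>2"
  proof (rule norm_blinfun_bound)
    show "0 \<le> ?c * (\<eta> - \<xi>)\<^sup>2"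
      using K_pos G Gamma_real_pos[of "a + 2"] a by simp
    fix x
    let ?\<phi> = "\<lambda>s. s powr (a - 1) * (exp (- (\<eta> * s)) - exp (- (\<xi> * s)) + (\<eta> - \<xi>) * s * exp (- (\<xi> * s)))"
    have hi: "((\<lambda>s. s powr (a - 1) *\<^sub>R S \<xi> s x) has_integral Gamma a *\<^sub>R X.W a x) {0<..}"
      "((\<lambda>s. s powr (a - 1) *\<^sub>R S \<eta> s x) has_integral Gamma a *\<^sub>R Y.W a x) {0<..}"
      "((\<lambda>s. s powr (a + 1 - 1) *\<^sub>R S \<xi> s x) has_integral Gamma (a + 1) *\<^sub>R X.W (a + 1) x) {0<..}"
      using X.W_has_integral[OF a] Y.W_has_integral[OF a] X.W_has_integral[of "a + 1"] a by auto
    have "Gamma (a + 1) = a * Gamma a" using a by (intro Gamma_plus1) auto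
    then have "Gamma a *\<^sub>R Y.W a x - Gamma a *\<^sub>R X.W a x + (\<eta> - \<xi>) *\<^sub>R (Gamma (a + 1) *\<^sub>R X.W (a + 1) x) =
        Gamma a *\<^sub>R (Y.W a - X.W a - (\<eta> - \<xi>) *\<^sub>R (- (a *\<^sub>R X.W (a + 1)))) x"
      by (simp add: blinfun.diff_left blinfun.add_left blinfun.scaleR_left blinfun.minus_left
          scaleR_diff_right scaleR_add_right mult_ac)
    moreover have "((\<lambda>s. s powr (a - 1) *\<^sub>R S \<eta> s x - s powr (a - 1) *\<^sub>R S \<xi> s x + (\<eta> - \<xi>) *\<^sub>R (s powr (a + 1 - 1) *\<^sub>R S \<xi> s x))
        has_integral (Gamma a *\<^sub>R Y.W a x - Gamma a *\<^sub>R X.W a x + (\<eta> - \<xi>) *\<^sub>R (Gamma (a + 1) *\<^sub>R X.W (a + 1) x))) {0<..}"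
      by (intro has_integral_add has_integral_diff has_integral_cmul hi)
    ultimately have "((\<lambda>s. s powr (a - 1) *\<^sub>R S \<eta> s x - s powr (a - 1) *\<^sub>R S \<xi> s x + (\<eta> - \<xi>) *\<^sub>R (s powr (a + 1 - 1) *\<^sub>R S \<xi> s x))
        has_integral Gamma a *\<^sub>R (Y.W a - X.W a - (\<eta> - \<xi>) *\<^sub>R (- (a *\<^sub>R X.W (a + 1)))) x) {0<..}"
      by simp
    then have "((\<lambda>s. ?\<phi> s *\<^sub>R T s x)
        has_integral Gamma a *\<^sub>R (Y.W a - X.W a - (\<eta> - \<xi>) *\<^sub>R (- (a *\<^sub>R X.W (a + 1)))) x) {0<..}"
    proof (rule has_integral_eq[rotated])
      fix s :: real assume "s \<in> {0<..}"
      then have p: "s powr (a + 1 - 1) = s powr (a - 1) * s" by (simp add: powr_diff)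
      show "s powr (a - 1) *\<^sub>R S \<eta> s x - s powr (a - 1) *\<^sub>R S \<xi> s x + (\<eta> - \<xi>) *\<^sub>R (s powr (a + 1 - 1) *\<^sub>R S \<xi> s x) = ?\<phi> s *\<^sub>R T s x"
        unfolding p by (simp add: S_def blinfun.scaleR_left flip: scaleR_diff_left scaleR_add_left)
          (simp add: algebra_simps)
    qed
    then have eq: "integral {0<..} (\<lambda>s. ?\<phi> s *\<^sub>R T s x) =
        Gamma a *\<^sub>R (Y.W a - X.W a - (\<eta> - \<xi>) *\<^sub>R (- (a *\<^sub>R X.W (a + 1)))) x"
      by (rule integral_unique)
    have "norm (integral {0<..} (\<lambda>s. ?\<phi> s *\<^sub>R T s x)) \<le> (\<eta> - \<xi>)\<^sup>2 * K * norm x * (Gamma (a + 2) / w powr (a + 2))"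
    proof (rule norm_weighted_integral)
      show "continuous_on {0<..} ?\<phi>" by (auto intro!: continuous_intros)
      fix s :: real assume s: "s > 0"
      have "\<bar>exp (- (\<eta> * s)) - exp (- (\<xi> * s)) + (\<eta> - \<xi>) * s * exp (- (\<xi> * s))\<bar> \<le> (\<eta> * s - \<xi> * s)\<^sup>2"
        using exp_second_order_remainder[of "\<xi> * s" "\<eta> * s"] s \<xi> \<eta> by (simp add: left_diff_distrib)
      then have "\<bar>?\<phi> s\<bar> \<le> s powr (a - 1) * (\<eta> * s - \<xi> * s)\<^sup>2"
        unfolding abs_mult by (intro mult_mono) auto
      also have "\<dots> = (\<eta> - \<xi>)\<^sup>2 * (s powr (a - 1) * s powr 2)"
        using s by (simp add: power_mult_distrib flip: left_diff_distrib)
      also have "s powr (a - 1) * s powr 2 = s powr (a + 2 - 1)"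
        by (simp add: algebra_simps flip: powr_add)
      finally show "\<bar>?\<phi> s\<bar> \<le> (\<eta> - \<xi>)\<^sup>2 * s powr (a + 2 - 1)" .
    qed (use a in auto)
    moreover define z where "z = (Y.W a - X.W a - (\<eta> - \<xi>) *\<^sub>R (- (a *\<^sub>R X.W (a + 1)))) x"
    ultimately have "norm z * Gamma a \<le> (\<eta> - \<xi>)\<^sup>2 * K * norm x * (Gamma (a + 2) / w powr (a + 2))"
      unfolding eq norm_scaleR using G by (simp add: mult.commute)
    then have "norm z \<le> (\<eta> - \<xi>)\<^sup>2 * K * norm x * (Gamma (a + 2) / w powr (a + 2)) / Gamma a"
      using pos_le_divide_eq[OF G] by blast
    then show "norm ((Y.W a - X.W a - (\<eta> - \<xi>) *\<^sub>R (- (a *\<^sub>R X.W (a + 1)))) x) \<le> ?c * (\<eta> - \<xi>)\<^sup>2 * norm x"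
      unfolding z_def[symmetric] by (simp add: mult_ac)
  qed
qed

end

section \<open>Integration over the shift and the final decay rates\<close>

context hilbert_exp_stable_semigroup
begin

lemma shifted_hilbert_semigroup: "\<xi> \<ge> 0 \<Longrightarrow> hilbert_exp_stable_semigroup (S \<xi>) K (w + \<xi>)"
  using shifted_semigroup by (simp add: hilbert_exp_stable_semigroup_def)

lemma norm_E_W_base:
  assumes a: "0 < a" "a \<le> 1" and t: "t > 0"
  shows "norm (E t o\<^sub>L W a) \<le> 3 * decay_const a * (2 / a) * w powr (- a / 2) * t powr (- a / 2)"
proof -
  define W' where "W' = (\<lambda>\<xi> b. neg_frac_pow (S \<xi>) b)"
  define F where "F = (\<lambda>\<xi>. blinfun_exp (t *\<^sub>R (- W' \<xi> 1)) o\<^sub>L W' \<xi> a)"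
  \<comment> \<open>The product rule. The exponent is left as \<open>1 + 1\<close> because
    \<open>W_Suc\<close> then splits it into two copies of the shifted \<open>R\<close>.\<close>
  define F' where "F' = (\<lambda>\<xi>. (blinfun_exp (t *\<^sub>R (- W' \<xi> 1)) o\<^sub>L (- (a *\<^sub>R W' \<xi> (a + 1)))) +
      ((blinfun_exp (t *\<^sub>R (- W' \<xi> 1)) o\<^sub>L (t *\<^sub>R W' \<xi> (1 + 1))) o\<^sub>L W' \<xi> a))"
  \<comment> \<open>The 3 is 2 + 1: a times the 2/a of \<open>norm_W_E_R\<close>, and one from
    \<open>norm_W_E_R2\<close>, where t * t^(-1-a/2) is t^(-a/2).\<close>
  define D where "D = 3 * decay_const a * t powr (- a / 2)"
  have D: "D \<ge> 0" using decay_const_pos[OF a(1)] by (simp add: D_def)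
  have deriv: "(F has_vector_derivative F' \<xi>) (at \<xi> within {0..})" if "\<xi> \<ge> 0" for \<xi>
  proof -
    have "((\<lambda>\<xi>. t *\<^sub>R (- W' \<xi> 1)) has_vector_derivative t *\<^sub>R (- (- (1 *\<^sub>R W' \<xi> (1 + 1))))) (at \<xi> within {0..})"
      unfolding W'_def
      by (intro bounded_linear.has_vector_derivative[OF bounded_linear_scaleR_right]
          has_vector_derivative_minus shifted_W_has_vector_derivative that) simp
    then have d: "((\<lambda>\<xi>. t *\<^sub>R (- W' \<xi> 1)) has_vector_derivative t *\<^sub>R W' \<xi> (1 + 1)) (at \<xi> within {0..})"
      by simp
    have "((\<lambda>\<xi>. blinfun_exp (t *\<^sub>R (- W' \<xi> 1))) has_vector_derivative
        (blinfun_exp (t *\<^sub>R (- W' \<xi> 1)) o\<^sub>L (t *\<^sub>R W' \<xi> (1 + 1)))) (at \<xi> within {0..})"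
      by (rule blinfun_exp_has_vector_derivative[OF d])
        (use that in \<open>auto simp: W'_def blinfun_compose.scaleR_left blinfun_compose.scaleR_right
          blinfun_compose.minus_left blinfun_compose.minus_right intro: shifted_W_W_commute\<close>)
    moreover have "((\<lambda>\<xi>. W' \<xi> a) has_vector_derivative - (a *\<^sub>R W' \<xi> (a + 1))) (at \<xi> within {0..})"
      unfolding W'_def by (rule shifted_W_has_vector_derivative[OF that a(1)])
    ultimately show ?thesis
      unfolding F_def F'_def by (rule bounded_bilinear.has_vector_derivative[OF bounded_bilinear_blinfun_compose])
  qed
  have bound: "norm (F' \<xi>) \<le> D * (w + \<xi>) powr (- a / 2 - 1)" if "\<xi> \<ge> 0" for \<xi>
  proof (rule norm_blinfun_bound)
    interpret X: hilbert_exp_stable_semigroup "S \<xi>" K "w + \<xi>" by (rule shifted_hilbert_semigroup[OF that])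
    fix x
    have F'x: "F' \<xi> x = - (a *\<^sub>R X.W a (X.E t (X.R x))) + t *\<^sub>R X.W a (X.E t (X.R (X.R x)))"
      unfolding F'_def W'_def X.W_Suc[OF a(1)] X.W_Suc[OF zero_less_one] X.W_E_apply[OF a(1)] X.W_R_apply[OF a(1)]
      by (simp only: blinfun_apply_blinfun_compose blinfun.add_left blinfun.minus_left blinfun.minus_right
          blinfun.scaleR_left blinfun.scaleR_right)
    have 1: "norm (X.W a (X.E t (X.R x))) \<le> decay_const a * (w + \<xi>) powr (- 1 - a / 2) * (2 / a) * t powr (- a / 2) * norm x"
      by (rule X.norm_W_E_R[OF a t])
    have 2: "norm (X.W a (X.E t (X.R (X.R x)))) \<le> decay_const a * (t * (w + \<xi>)) powr (- 1 - a / 2) * norm x"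
      by (rule X.norm_W_E_R2[OF a t])
    have "norm (F' \<xi> x) \<le> a * norm (X.W a (X.E t (X.R x))) + t * norm (X.W a (X.E t (X.R (X.R x))))"
      unfolding F'x by (rule order_trans[OF norm_triangle_ineq]) (use a t in simp)
    also have "\<dots> \<le> a * (decay_const a * (w + \<xi>) powr (- 1 - a / 2) * (2 / a) * t powr (- a / 2) * norm x) +
        t * (decay_const a * (t * (w + \<xi>)) powr (- 1 - a / 2) * norm x)"
      by (intro add_mono mult_left_mono 1 2) (use a t in auto)
    also have "t * (decay_const a * (t * (w + \<xi>)) powr (- 1 - a / 2) * norm x) =
        decay_const a * (w + \<xi>) powr (- 1 - a / 2) * t powr (- a / 2) * norm x"
    proof -
      have "t * t powr (- 1 - a / 2) = t powr (- a / 2)"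
        using t powr_add[of t 1 "- 1 - a / 2"] by simp
      then show ?thesis using t w_pos that by (simp add: powr_mult)
    qed
    also have "a * (decay_const a * (w + \<xi>) powr (- 1 - a / 2) * (2 / a) * t powr (- a / 2) * norm x) + \<dots> =
        D * (w + \<xi>) powr (- a / 2 - 1) * norm x"
    proof -
      have e: "- 1 - a / 2 = - a / 2 - 1" by simp
      show ?thesis unfolding e using a by (simp add: D_def)
    qed
    finally show "norm (F' \<xi> x) \<le> D * (w + \<xi>) powr (- a / 2 - 1) * norm x" .
  qed (use D in simp)
  \<comment> \<open>A primitive of the bound on \<open>F'\<close>. It is negative and tends to 0, so
    its increment from 0 is at most D (2/a) w^(-a/2).\<close>
  let ?\<phi> = "\<lambda>\<xi>. - (D * (2 / a) * (w + \<xi>) powr (- a / 2))"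
  have le: "norm (F N - F 0) \<le> D * (2 / a) * w powr (- a / 2)" if "N > 0" for N
  proof -
    have "norm (F N - F 0) \<le> ?\<phi> N - ?\<phi> 0"
    proof (rule differentiable_bound_general[OF that])
      show "continuous_on {0..N} F"
      proof (rule continuous_on_subset)
        show "continuous_on {0..} F"
          unfolding continuous_on_eq_continuous_within
          using has_vector_derivative_continuous[OF deriv] by auto
      qed auto
      show "continuous_on {0..N} ?\<phi>"
        by (intro continuous_intros) (use w_pos in auto)
      fix \<xi> :: real assume \<xi>: "0 < \<xi>"
      have "at \<xi> within {0..} = at \<xi>" using \<xi> by (intro at_within_interior) auto
      then show "(F has_vector_derivative F' \<xi>) (at \<xi>)" using deriv[of \<xi>] \<xi> by simp
      have "((\<lambda>\<xi>. (w + \<xi>) powr (- a / 2)) has_real_derivative (- a / 2) * (w + \<xi>) powr (- a / 2 - 1) * 1) (at \<xi>)"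
        by (rule DERIV_chain2[OF has_real_derivative_powr]) (use w_pos \<xi> in \<open>auto intro!: derivative_eq_intros\<close>)
      then have "(?\<phi> has_real_derivative - (D * (2 / a) * ((- a / 2) * (w + \<xi>) powr (- a / 2 - 1) * 1))) (at \<xi>)"
        by (intro DERIV_minus DERIV_cmult)
      then show "(?\<phi> has_vector_derivative D * (w + \<xi>) powr (- a / 2 - 1)) (at \<xi>)"
        using a by (simp add: has_real_derivative_iff_has_vector_derivative)
      show "norm (F' \<xi>) \<le> D * (w + \<xi>) powr (- a / 2 - 1)" using bound \<xi> by simp
    qed
    moreover have "D * (2 / a) * (w + N) powr (- a / 2) \<ge> 0" using D a by simp
    ultimately show ?thesis by simp
  qed
  \<comment> \<open>For fixed t the exponentials stay bounded as the shift grows, while the shifted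
    negative power tends to 0 in norm. The bound exp(t K / w) is crude in t, but only the limit
    matters.\<close>
  have lim: "(F \<longlongrightarrow> 0) at_top"
  proof (rule Lim_null_comparison)
    have "((\<lambda>N. exp (t * (K / w)) * (K * (w + N) powr - a)) \<longlongrightarrow> exp (t * (K / w)) * (K * 0)) at_top"
      by (intro tendsto_mult tendsto_const tendsto_neg_powr filterlim_tendsto_add_at_top[OF tendsto_const filterlim_ident])
        (use a in auto)
    then show "((\<lambda>N. exp (t * (K / w)) * (K * (w + N) powr - a)) \<longlongrightarrow> 0) at_top" by simp
    show "\<forall>\<^sub>F N in at_top. norm (F N) \<le> exp (t * (K / w)) * (K * (w + N) powr - a)"
      using eventually_ge_at_top[of 0]
    proof eventually_elim
      case (elim N)
      interpret X: hilbert_exp_stable_semigroup "S N" K "w + N" by (rule shifted_hilbert_semigroup[OF elim])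
      have "norm (F N) \<le> norm (X.E t) * norm (X.W a)"
        by (simp add: F_def W'_def norm_blinfun_compose)
      also have "\<dots> \<le> exp (t * (K / w)) * (K * (w + N) powr - a)"
      proof (intro mult_mono)
        have "norm X.R \<le> K / (w + N)" using X.norm_W[of 1] X.w_pos by simp
        also have "\<dots> \<le> K / w" using elim K_pos w_pos by (intro divide_left_mono) auto
        finally have "norm (t *\<^sub>R (- X.R)) \<le> t * (K / w)"
          using t mult_left_mono[of "norm X.R" "K / w" t] by simp
        then show "norm (X.E t) \<le> exp (t * (K / w))"
          using norm_blinfun_exp[of "t *\<^sub>R (- X.R)"] by (meson exp_le_cancel_iff order_trans)
        show "norm (X.W a) \<le> K * (w + N) powr - a"
          using X.norm_W[OF a(1)] by (simp add: powr_minus divide_inverse)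
      qed auto
      finally show ?case .
    qed
  qed
  have "norm (0 - F 0) \<le> D * (2 / a) * w powr (- a / 2)"
  proof (rule tendsto_upperbound[OF tendsto_norm[OF tendsto_diff[OF lim tendsto_const]]])
    show "\<forall>\<^sub>F N in at_top. norm (F N - F 0) \<le> D * (2 / a) * w powr (- a / 2)"
      using eventually_gt_at_top[of 0] by eventually_elim (rule le)
  qed simp
  moreover have "F 0 = E t o\<^sub>L W a" by (simp add: F_def W'_def S_0)
  ultimately show ?thesis by (simp add: D_def mult_ac)
qed

lemma norm_E_W:
  assumes "0 < a" "a \<le> 1"
  shows "\<exists>M>0. \<forall>t>0. norm (E t o\<^sub>L W (a + real n)) \<le> M * t powr (- (a + real n) / 2)"
proof (induction n)
  case 0
  show ?case
  proof (intro exI conjI allI impI)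
    show "0 < 3 * decay_const a * (2 / a) * w powr (- a / 2)" using decay_const_pos assms w_pos by simp
    show "norm (E t o\<^sub>L W (a + real 0)) \<le> 3 * decay_const a * (2 / a) * w powr (- a / 2) * t powr (- (a + real 0) / 2)"
      if "t > 0" for t using norm_E_W_base[OF assms that] by simp
  qed
next
  case (Suc n)
  let ?a = "a + real n"
  from Suc obtain M where M: "M > 0" "\<And>t. t > 0 \<Longrightarrow> norm (E t o\<^sub>L W ?a) \<le> M * t powr (- ?a / 2)" by blast
  define M1 where "M1 = 3 * decay_const 1 * (2 / 1) * w powr (- 1 / 2)"
  have M1: "M1 > 0" "\<And>t. t > 0 \<Longrightarrow> norm (E t o\<^sub>L R) \<le> M1 * t powr (- 1 / 2)"
    using norm_E_W_base[of 1] decay_const_pos[of 1] w_pos by (auto simp: M1_def)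
  show ?case
  proof (intro exI conjI allI impI)
    \<comment> \<open>The power of 2 is the price of halving t in both factors.\<close>
    show "0 < M1 * M * 2 powr ((?a + 1) / 2)" using M M1 by simp
    fix t :: real assume t: "t > 0"
    have "E t o\<^sub>L W (?a + 1) = (E (t / 2) o\<^sub>L R) o\<^sub>L (E (t / 2) o\<^sub>L W ?a)"
      using W_Suc[of ?a] assms by (intro blinfun_eqI) (simp only: blinfun_apply_blinfun_compose R_E_apply E_half[of t] add_pos_nonneg of_nat_0_le_iff)
    then have "norm (E t o\<^sub>L W (?a + 1)) \<le> norm (E (t / 2) o\<^sub>L R) * norm (E (t / 2) o\<^sub>L W ?a)"
      by (simp only: norm_blinfun_compose)
    also have "\<dots> \<le> (M1 * (t / 2) powr (- 1 / 2)) * (M * (t / 2) powr (- ?a / 2))"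
      by (intro mult_mono M M1) (use t M1 in auto)
    also have "\<dots> = M1 * M * (t / 2) powr (- (?a + 1) / 2)"
    proof -
      have "- (?a + 1) / 2 = - 1 / 2 + - ?a / 2" by (simp add: field_simps)
      then show ?thesis by (simp only: powr_add mult_ac)
    qed
    also have "\<dots> = M1 * M * 2 powr ((?a + 1) / 2) * t powr (- (?a + 1) / 2)"
    proof -
      have "(t / 2) powr (- q) = 2 powr q * t powr (- q)" for q
        using t by (simp add: powr_divide powr_minus_divide)
      from this[of "(?a + 1) / 2"] show ?thesis by (simp only: minus_divide_left mult.assoc)
    qed
    finally show "norm (E t o\<^sub>L W (a + real (Suc n))) \<le> M1 * M * 2 powr ((?a + 1) / 2) * t powr (- (a + real (Suc n)) / 2)"
      by (simp add: add_ac)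
  qed
qed

end

theorem theorem2p4:
  fixes T :: "real \<Rightarrow> ('a::{real_inner, banach} \<Rightarrow>\<^sub>L 'a)"
    and \<alpha> :: real
  assumes "c0_semigroup T"
    and "exp_stable T"
    and "\<alpha> > 0"
  shows "\<exists>M > 0. \<exists>t0 > 0. \<forall>t \<ge> t0.
           norm (blinfun_exp (t *\<^sub>R gen_inv T) o\<^sub>L neg_frac_pow T \<alpha>) \<le> M / t powr (\<alpha> / 2)"
proof -
  from assms(2) obtain K w where "K > 0" "w > 0" "\<forall>t\<ge>0. norm (T t) \<le> K * exp (- w * t)"
    by (auto simp: exp_stable_def)
  then interpret hilbert_exp_stable_semigroup T K w
    by unfold_locales (use assms(1) in auto)
  \<comment> \<open>The ceiling minus one, not the floor: the fractional part must be positive and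
    may equal 1.\<close>
  define n where "n = nat (\<lceil>\<alpha>\<rceil> - 1)"
  have n: "0 < \<alpha> - real n" "\<alpha> - real n \<le> 1" using assms(3) unfolding n_def by linarith+
  obtain M where M: "M > 0" "\<And>t. t > 0 \<Longrightarrow> norm (E t o\<^sub>L W \<alpha>) \<le> M * t powr (- \<alpha> / 2)"
    using norm_E_W[OF n, of n] by auto
  \<comment> \<open>The estimate holds for every t > 0; the witness t0 = 1 is one choice.\<close>
  have "norm (blinfun_exp (t *\<^sub>R gen_inv T) o\<^sub>L neg_frac_pow T \<alpha>) \<le> M / t powr (\<alpha> / 2)" if "t \<ge> 1" for t
    using M(2)[of t] that by (simp add: gen_inv_eq powr_minus_divide)
  then show ?thesis
    using M(1) zero_less_one by blast
qed

end
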